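(* The Schwarz genus of the covering $E_{\mathrm{btg}}\to B_{\mathrm{btg}}$, $(F,l_1,\dots,l_{28})\mapsto F$, satisfies $g(E_{\mathrm{btg}}\to B_{\mathrm{btg}})\ge 9$.
   Context: Let $B_{\mathrm{btg}}$ be the space of nonsingular homogeneous quartic polynomials $F(x,y,z)$ over $\mathbb{C}$ modulo scaling by $\mathbb{C}^\times$, an open submanifold of $\mathbb{CP}^{14}$ (the projective space of all homogeneous quartic polynomials in three variables). Every smooth quartic curve in $\mathbb{CP}^2$ has exactly 28 bitangent lines (a line is bitangent if its intersection divisor with the curve has the form $2P+2Q$, $P=Q$ allowed). Let $E_{\mathrm{btg}}$ be the space of tuples $(F,l_1,\dots,l_{28})$ with $F\in B_{\mathrm{btg}}$ and $l_1,\dots,l_{28}$ the 28 distinct bitangent lines to the curve $F=0$ in some order (topologized as a subspace of $B_{\mathrm{btg}}\times((\mathbb{CP}^2)^\vee)^{28}$, where $(\mathbb{CP}^2)^\vee$ is the space of lines in $\mathbb{CP}^2$). The projection $E_{\mathrm{btg}}\to B_{\mathrm{btg}}$ is a normal $S_{28}$-cover (principal $S_{28}$-bundle; the total space need not be connected). The Schwarz genus $g(E\to B)$ of a covering $E\to B$ is the minimum size of an open cover of $B$ such that the covering map $E\to B$ has a continuous section over each open set of the cover. *)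

theory Defs
  imports
    "HOL-Analysis.Analysis"
    "HOL-Computational_Algebra.Polynomial"
    "HOL-Library.Extended_Nat"
begin

section \<open>Complex projective space\<close>

text \<open>Points are nonzero vectors up to scaling, with the quotient topology of the punctured
  vector space. The dimension is one less than the size of the index type.\<close>

quotient_type 'n cproj = "complex ^ ('n::finite)" /
  partial: "\<lambda>v w. v \<noteq> 0 \<and> (\<exists>c. c \<noteq> 0 \<and> w = c *s v)"
proof (rule part_equivpI)
  show "\<exists>x::complex^'n. x \<noteq> 0 \<and> (\<exists>c. c \<noteq> 0 \<and> x = c *s x)"
    by (rule exI[of _ "1"]) (auto intro!: exI[of _ "1::complex"])
  show "symp (\<lambda>v w::complex^'n. v \<noteq> 0 \<and> (\<exists>c. c \<noteq> 0 \<and> w = c *s v))"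
  proof (rule sympI)
    fix v w :: "complex^'n"
    assume "v \<noteq> 0 \<and> (\<exists>c. c \<noteq> 0 \<and> w = c *s v)"
    then obtain c where "v \<noteq> 0" "c \<noteq> 0" "w = c *s v" by blast
    then have "w \<noteq> 0" "v = inverse c *s w"
      by (auto simp: vec.scale_eq_0_iff)
    with \<open>c \<noteq> 0\<close> show "w \<noteq> 0 \<and> (\<exists>c. c \<noteq> 0 \<and> v = c *s w)"
      using nonzero_imp_inverse_nonzero by blast
  qed
  show "transp (\<lambda>v w::complex^'n. v \<noteq> 0 \<and> (\<exists>c. c \<noteq> 0 \<and> w = c *s v))"
  proof (rule transpI)
    fix u v w :: "complex^'n"
    assume "u \<noteq> 0 \<and> (\<exists>c. c \<noteq> 0 \<and> v = c *s u)" "v \<noteq> 0 \<and> (\<exists>c. c \<noteq> 0 \<and> w = c *s v)"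
    then obtain c d where "u \<noteq> 0" "c \<noteq> 0" "d \<noteq> 0" "w = (d * c) *s u" by auto
    then show "u \<noteq> 0 \<and> (\<exists>c. c \<noteq> 0 \<and> w = c *s u)"
      using mult_eq_0_iff by metis
  qed
qed

instantiation cproj :: (finite) topological_space
begin

definition open_cproj :: "'a cproj set \<Rightarrow> bool"
  where "open_cproj U \<longleftrightarrow> open {v. v \<noteq> 0 \<and> abs_cproj v \<in> U}"

instance
proof
  have "{v :: complex^'a. v \<noteq> 0 \<and> abs_cproj v \<in> UNIV} = - {0}" by auto
  then show "open (UNIV :: 'a cproj set)"
    by (simp add: open_cproj_def open_Compl)
next
  fix S T :: "'a cproj set"
  assume "open S" "open T"
  moreover have "{v. v \<noteq> 0 \<and> abs_cproj v \<in> S \<inter> T} =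
    {v. v \<noteq> 0 \<and> abs_cproj v \<in> S} \<inter> {v. v \<noteq> 0 \<and> abs_cproj v \<in> T}" by auto
  ultimately show "open (S \<inter> T)" by (simp add: open_cproj_def open_Int)
next
  fix K :: "'a cproj set set"
  assume "\<forall>S\<in>K. open S"
  moreover have "{v. v \<noteq> 0 \<and> abs_cproj v \<in> \<Union>K} = (\<Union>S\<in>K. {v. v \<noteq> 0 \<and> abs_cproj v \<in> S})"
    by auto
  ultimately show "open (\<Union>K)" by (auto simp: open_cproj_def)
qed

end

section \<open>Ternary quartic forms\<close>

typedef quartic_exp = "{e :: 3 \<Rightarrow> nat. (\<Sum>i\<in>UNIV. e i) = 4}"
  morphisms expo Abs_quartic_exp
  by (rule exI[of _ "\<lambda>i. if i = 1 then 4 else 0"]) simp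

lemma quartic_exp_set_eq:
  "{e :: 3 \<Rightarrow> nat. (\<Sum>i\<in>UNIV. e i) = 4} =
   (\<lambda>(a,b) i. if i = 1 then a else if i = 2 then b else 4 - a - b) `
     (SIGMA a:{..4}. {..4 - a})" (is "?L = ?f ` ?R")
proof (intro equalityI subsetI)
  fix e :: "3 \<Rightarrow> nat" assume "e \<in> ?L"
  then have s: "e 1 + e 2 + e 3 = 4" by (simp add: sum_3)
  have "e = ?f (e 1, e 2)"
  proof
    fix i :: 3 show "e i = ?f (e 1, e 2) i"
      using exhaust_3[of i] s by auto
  qed
  then show "e \<in> ?f ` ?R" using s by (intro image_eqI[of _ _ "(e 1, e 2)"]) auto
qed (auto simp: sum_3)

instance quartic_exp :: finite
proof
  have "finite {e :: 3 \<Rightarrow> nat. (\<Sum>i\<in>UNIV. e i) = 4}"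
    unfolding quartic_exp_set_eq by (intro finite_imageI finite_SigmaI) auto
  then show "finite (UNIV :: quartic_exp set)"
    by (metis type_definition.univ[OF type_definition_quartic_exp] finite_imageI)
qed

lemma card_quartic_exp: "CARD(quartic_exp) = 15"
proof -
  let ?f = "\<lambda>(a::nat,b::nat) (i::3). if i = 1 then a else if i = 2 then b else 4 - a - b"
  have "inj ?f"
    by (rule injI) (auto simp: fun_eq_iff split: if_splits dest: spec[of _ "1::3"] spec[of _ "2::3"])
  then have "card (?f ` (SIGMA a:{..4}. {..4 - a})) = card (SIGMA a:{..4::nat}. {..4 - a})"
    by (intro card_image) (auto intro: inj_on_subset)
  also have "\<dots> = 15" by (simp add: card_SigmaI eval_nat_numeral)
  finally show ?thesis
    by (simp add: type_definition.card[OF type_definition_quartic_exp] quartic_exp_set_eq)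
qed

text \<open>A ternary quartic form is its coefficient vector.\<close>

definition quartic_eval :: "complex ^ quartic_exp \<Rightarrow> complex ^ 3 \<Rightarrow> complex"
  where "quartic_eval F x = (\<Sum>e\<in>UNIV. F $ e * (\<Prod>i\<in>UNIV. x $ i ^ expo e i))"

definition quartic_partial :: "3 \<Rightarrow> complex ^ quartic_exp \<Rightarrow> complex ^ 3 \<Rightarrow> complex"
  where "quartic_partial i F x = deriv (\<lambda>t. quartic_eval F (x + axis i t)) 0"

definition nonsingular_form :: "complex ^ quartic_exp \<Rightarrow> bool"
  where "nonsingular_form F \<longleftrightarrow>
    \<not> (\<exists>x. x \<noteq> 0 \<and> quartic_eval F x = 0 \<and> (\<forall>i. quartic_partial i F x = 0))"

lemma quartic_eval_scale_form: "quartic_eval (c *s F) x = c * quartic_eval F x"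
  by (simp add: quartic_eval_def sum_distrib_left mult_ac)

lemma quartic_eval_scale_point: "quartic_eval F (c *s x) = c ^ 4 * quartic_eval F x"
proof -
  have "(\<Prod>i\<in>UNIV. (c *s x) $ i ^ expo e i) = c ^ 4 * (\<Prod>i\<in>UNIV. x $ i ^ expo e i)" for e
  proof -
    have "(\<Prod>i\<in>UNIV. (c *s x) $ i ^ expo e i) =
        (\<Prod>i\<in>UNIV. c ^ expo e i) * (\<Prod>i\<in>UNIV. x $ i ^ expo e i)"
      by (simp add: power_mult_distrib prod.distrib)
    also have "(\<Prod>i\<in>UNIV. c ^ expo e i) = c ^ 4"
      using expo[of e] by (simp flip: power_sum)
    finally show ?thesis .
  qed
  then show ?thesis by (simp add: quartic_eval_def sum_distrib_left mult_ac)
qed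

text \<open>The polynomial \<open>F (p + t q)\<close> in the variable \<open>t\<close>.\<close>

definition restrict_poly :: "complex ^ quartic_exp \<Rightarrow> complex ^ 3 \<Rightarrow> complex ^ 3 \<Rightarrow> complex poly"
  where "restrict_poly F p q = (\<Sum>e\<in>UNIV. smult (F $ e) (\<Prod>i\<in>UNIV. [:p $ i, q $ i:] ^ expo e i))"

lemma poly_restrict_poly: "poly (restrict_poly F p q) t = quartic_eval F (p + t *s q)"
  by (simp add: restrict_poly_def quartic_eval_def poly_sum poly_prod mult_ac)

lemma degree_restrict_poly: "degree (restrict_poly F p q) \<le> 4"
proof -
  have "degree (\<Prod>i\<in>UNIV. [:p $ i, q $ i:] ^ expo e i) \<le> 4" for e
  proof -
    have "degree (\<Prod>i\<in>UNIV. [:p $ i, q $ i:] ^ expo e i) \<le>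
        (\<Sum>i\<in>UNIV. degree ([:p $ i, q $ i:] ^ expo e i))"
      using degree_prod_sum_le[of UNIV "\<lambda>i. [:p $ i, q $ i:] ^ expo e i"] by (simp add: o_def)
    also have "\<dots> \<le> (\<Sum>i\<in>UNIV. expo e i)"
    proof (rule sum_mono)
      fix i
      have "degree ([:p $ i, q $ i:] ^ expo e i) \<le> degree [:p $ i, q $ i:] * expo e i"
        by (rule degree_power_le)
      also have "\<dots> \<le> 1 * expo e i" by (intro mult_right_mono) auto
      finally show "degree ([:p $ i, q $ i:] ^ expo e i) \<le> expo e i" by simp
    qed
    also have "\<dots> = 4" using expo[of e] by simp
    finally show ?thesis .
  qed
  then show ?thesis unfolding restrict_poly_def
    by (intro degree_sum_le) (auto intro: order_trans[OF degree_smult_le])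
qed

lemma quartic_partial_scale_form: "quartic_partial i (c *s F) x = c * quartic_partial i F x"
proof -
  have "quartic_eval F (x + axis i t) = poly (restrict_poly F x (axis i 1)) t" for t
  proof -
    have "axis i t = t *s axis i (1::complex)" by (simp add: vec_eq_iff axis_def)
    then show ?thesis by (simp add: poly_restrict_poly)
  qed
  moreover have "poly (restrict_poly F x (axis i 1)) field_differentiable at 0"
    using poly_DERIV field_differentiable_def by blast
  ultimately have "(\<lambda>t. quartic_eval F (x + axis i t)) field_differentiable at 0"
    by simp
  then show ?thesis
    by (simp add: quartic_partial_def quartic_eval_scale_form)
qed

lift_definition nonsingular :: "quartic_exp cproj \<Rightarrow> bool" is nonsingular_form
  by (auto simp: nonsingular_form_def quartic_eval_scale_form quartic_partial_scale_form)

section \<open>Lines and their intersection divisors with quartics\<close>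

text \<open>The space of lines \<open>3 cproj\<close> in the projective plane is the projective space of coefficient vectors
  of linear forms.\<close>

definition incident_form :: "complex ^ 3 \<Rightarrow> complex ^ 3 \<Rightarrow> bool"
  where "incident_form a p \<longleftrightarrow> (\<Sum>i\<in>UNIV. a $ i * p $ i) = 0"

lemma incident_form_scale: "c \<noteq> 0 \<Longrightarrow> incident_form (c *s a) p \<longleftrightarrow> incident_form a p"
    "c \<noteq> 0 \<Longrightarrow> incident_form a (c *s p) \<longleftrightarrow> incident_form a p"
  by (simp_all add: incident_form_def mult_ac mult.left_commute[of _ c] flip: sum_distrib_left)

lemma restrict_poly_scale_form: "restrict_poly (c *s F) p q = smult c (restrict_poly F p q)"
  by (rule poly_eq_poly_eq_iff[THEN iffD1])
    (simp add: fun_eq_iff poly_restrict_poly quartic_eval_scale_form)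

text \<open>Reparametrising the line through \<open>p\<close> and \<open>q\<close> does not change the vanishing order at \<open>p\<close>.\<close>

lemma restrict_poly_reparam:
  fixes \<alpha> \<beta> c :: complex
  assumes c: "c \<noteq> 0"
  shows "restrict_poly F (c *s p) (\<alpha> *s p + \<beta> *s q) =
    (\<Sum>j\<le>4. smult (coeff (restrict_poly F p q) j) ([:c, \<alpha>:] ^ (4 - j) * [:0, \<beta>:] ^ j))"
    (is "?l = ?r")
proof -
  have eq: "poly ?l t = poly ?r t" if t: "c + \<alpha> * t \<noteq> 0" for t
  proof -
    define X where "X = c + \<alpha> * t"
    have X: "X \<noteq> 0" using t by (simp add: X_def)
    have "X * (t * \<beta> / X) = t * \<beta>" using X by simp
    then have "X *s (p + (t * \<beta> / X) *s q) = X *s p + (t * \<beta>) *s q"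
      by (simp only: vec.scale_right_distrib vec.scale_scale)
    then have "c *s p + t *s (\<alpha> *s p + \<beta> *s q) = X *s (p + (t * \<beta> / X) *s q)"
      by (simp add: vec_eq_iff X_def algebra_simps)
    then have "poly ?l t = X ^ 4 * poly (restrict_poly F p q) (t * \<beta> / X)"
      by (simp only: poly_restrict_poly quartic_eval_scale_point)
    also have "poly (restrict_poly F p q) (t * \<beta> / X) =
        (\<Sum>j\<le>4. coeff (restrict_poly F p q) j * (t * \<beta> / X) ^ j)"
      unfolding poly_altdef
      by (rule sum.mono_neutral_left) (auto simp: degree_restrict_poly coeff_eq_0)
    also have "X ^ 4 * \<dots> = (\<Sum>j\<le>4. coeff (restrict_poly F p q) j * (X ^ (4 - j) * (t * \<beta>) ^ j))"
      unfolding sum_distrib_left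
    proof (rule sum.cong)
      fix j :: nat assume "j \<in> {..4}"
      then have "X ^ 4 = X ^ (4 - j) * X ^ j" by (simp flip: power_add)
      then show "X ^ 4 * (coeff (restrict_poly F p q) j * (t * \<beta> / X) ^ j) =
          coeff (restrict_poly F p q) j * (X ^ (4 - j) * (t * \<beta>) ^ j)"
        using X by (simp add: power_divide)
    qed simp
    also have "\<dots> = poly ?r t" by (simp add: poly_sum X_def mult_ac)
    finally show ?thesis .
  qed
  have "?l - ?r = 0"
  proof (rule ccontr)
    assume "?l - ?r \<noteq> 0"
    then have fin: "finite {t. poly (?l - ?r) t = 0}" by (rule poly_roots_finite)
    have "[:c, \<alpha>:] \<noteq> 0" using c by simp
    then have "finite {t. poly [:c, \<alpha>:] t = 0}" by (rule poly_roots_finite)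
    with fin have "finite ({t. poly [:c, \<alpha>:] t = 0} \<union> {t. poly (?l - ?r) t = 0})"
      by (rule finite_UnI[rotated])
    moreover have "UNIV \<subseteq> {t. poly [:c, \<alpha>:] t = 0} \<union> {t. poly (?l - ?r) t = 0}"
    proof
      fix t
      show "t \<in> {t. poly [:c, \<alpha>:] t = 0} \<union> {t. poly (?l - ?r) t = 0}"
      proof (cases "c + \<alpha> * t = 0")
        case True
        then have "poly [:c, \<alpha>:] t = 0" by (simp add: mult.commute)
        then show ?thesis by (intro UnI1 CollectI)
      next
        case False
        then have "poly ?l t = poly ?r t" by (rule eq)
        then have "poly (?l - ?r) t = 0" by (simp only: poly_diff diff_self)
        then show ?thesis by (intro UnI2 CollectI)
      qed
    qed
    ultimately have "finite (UNIV :: complex set)" by (rule rev_finite_subset)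
    then show False by (simp add: infinite_UNIV_char_0)
  qed
  then show ?thesis by simp
qed

lemma order_restrict_poly_reparam:
  fixes \<alpha> \<beta> c :: complex
  assumes c: "c \<noteq> 0" and b: "\<beta> \<noteq> 0"
  shows "order 0 (restrict_poly F (c *s p) (\<alpha> *s p + \<beta> *s q)) = order 0 (restrict_poly F p q)"
proof -
  have zero: "restrict_poly F (c *s p) (\<alpha> *s p + \<beta> *s q) = 0"
    if "c \<noteq> 0" "restrict_poly F p q = 0" for c \<alpha> \<beta> :: complex and p q
    using that by (simp add: restrict_poly_reparam)
  have le: "order 0 (restrict_poly F p q) \<le> order 0 (restrict_poly F (c *s p) (\<alpha> *s p + \<beta> *s q))"
    if c: "c \<noteq> 0" and nz: "restrict_poly F (c *s p) (\<alpha> *s p + \<beta> *s q) \<noteq> 0" for c \<alpha> \<beta> :: complex and p q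
  proof -
    let ?r = "restrict_poly F p q"
    have "[:0, 1:] ^ order 0 ?r dvd
        (\<Sum>j\<le>4. smult (coeff ?r j) ([:c, \<alpha>:] ^ (4 - j) * [:0, \<beta>:] ^ j))"
    proof (rule dvd_sum)
      fix j :: nat
      show "[:0, 1:] ^ order 0 ?r dvd smult (coeff ?r j) ([:c, \<alpha>:] ^ (4 - j) * [:0, \<beta>:] ^ j)"
      proof (cases "j < order 0 ?r")
        case True
        have "[:0, 1:] ^ order 0 ?r dvd ?r" using order_1[of 0 ?r] by simp
        then have "monom 1 (order 0 ?r) dvd ?r" by (simp add: monom_altdef)
        then have "coeff ?r j = 0" using True by (simp add: monom_1_dvd_iff')
        then show ?thesis by simp
      next
        case False
        have "[:0, 1:] dvd [:0, \<beta>:]" by (rule dvdI[of _ _ "[:\<beta>:]"]) simp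
        then have "[:0, 1:] ^ j dvd [:0, \<beta>:] ^ j" by (rule dvd_power_same)
        moreover have "[:0, 1:] ^ order 0 ?r dvd [:0, 1::complex:] ^ j"
          using False by (intro le_imp_power_dvd) simp
        ultimately show ?thesis by (intro dvd_smult dvd_mult) (rule dvd_trans)
      qed
    qed
    then have "[:-0, 1:] ^ order 0 ?r dvd restrict_poly F (c *s p) (\<alpha> *s p + \<beta> *s q)"
      using c by (simp add: restrict_poly_reparam)
    then show ?thesis using nz by (metis order_divides minus_zero)
  qed
  let ?p = "c *s p" and ?q = "\<alpha> *s p + \<beta> *s q"
  have p: "p = inverse c *s ?p" using c by (simp add: vec_eq_iff)
  have q: "q = (- (\<alpha> / (\<beta> * c))) *s ?p + inverse \<beta> *s ?q"
    using c b by (simp add: vec_eq_iff field_simps)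
  show ?thesis
  proof (cases "restrict_poly F p q = 0")
    case True
    then show ?thesis using zero[OF c True, of \<alpha> \<beta>] by simp
  next
    case False
    have nz: "restrict_poly F ?p ?q \<noteq> 0"
      using False zero[of "inverse c" ?p ?q "- (\<alpha> / (\<beta> * c))" "inverse \<beta>"] c
      unfolding p[symmetric] q[symmetric] by auto
    have "order 0 (restrict_poly F ?p ?q) \<le> order 0 (restrict_poly F p q)"
      using le[of "inverse c" ?p "- (\<alpha> / (\<beta> * c))" "inverse \<beta>" ?q] False c
      unfolding p[symmetric] q[symmetric] by auto
    then show ?thesis using le[OF c nz] by simp
  qed
qed

text \<open>The intersection multiplicity at \<open>p\<close> of the line \<open>a\<close> with the quartic \<open>F\<close>: the vanishing order
  at \<open>p\<close> of the restriction of \<open>F\<close> to the line, computed with an auxiliary second point \<open>q\<close> of the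
  line. If the line is a component of the quartic, the restriction is zero and its order is
  unspecified; this does not happen for nonsingular quartics.\<close>

definition second_point :: "complex ^ 3 \<Rightarrow> complex ^ 3 \<Rightarrow> complex ^ 3 \<Rightarrow> bool"
  where "second_point a p q \<longleftrightarrow> incident_form a q \<and> (\<nexists>c. q = c *s p)"

definition intersection_mult_form ::
    "complex ^ quartic_exp \<Rightarrow> complex ^ 3 \<Rightarrow> complex ^ 3 \<Rightarrow> nat"
  where "intersection_mult_form F a p =
    (if incident_form a p then order 0 (restrict_poly F p (SOME q. second_point a p q)) else 0)"

lemma second_point_scale:
  assumes "c \<noteq> 0"
  shows "second_point (c *s a) p = second_point a p" "second_point a (c *s p) = second_point a p"
proof -
  have "(\<exists>d. q = d *s (c *s p)) \<longleftrightarrow> (\<exists>d. q = d *s p)" for q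
  proof
    assume "\<exists>d. q = d *s p"
    then obtain d where "q = d *s p" ..
    then have "q = (d / c) *s (c *s p)" using assms by simp
    then show "\<exists>d. q = d *s (c *s p)" ..
  qed auto
  then show "second_point (c *s a) p = second_point a p" "second_point a (c *s p) = second_point a p"
    using assms by (auto simp: fun_eq_iff second_point_def incident_form_scale)
qed

lift_definition intersection_mult :: "quartic_exp cproj \<Rightarrow> 3 cproj \<Rightarrow> 3 cproj \<Rightarrow> nat"
  is intersection_mult_form
proof -
  fix F F' :: "complex ^ quartic_exp" and a a' p p' :: "complex ^ 3"
  assume "F \<noteq> 0 \<and> (\<exists>c. c \<noteq> 0 \<and> F' = c *s F)" "a \<noteq> 0 \<and> (\<exists>c. c \<noteq> 0 \<and> a' = c *s a)"
    "p \<noteq> 0 \<and> (\<exists>c. c \<noteq> 0 \<and> p' = c *s p)"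
  then obtain c d e where *: "c \<noteq> 0" "d \<noteq> 0" "e \<noteq> 0" "F' = c *s F" "a' = d *s a" "p' = e *s p"
    by blast
  have "order 0 (restrict_poly F (e *s p) q) = order 0 (restrict_poly F p q)" for q
    using order_restrict_poly_reparam[of e 1 F p 0 q] * by simp
  then show "intersection_mult_form F a p = intersection_mult_form F' a' p'"
    using * by (simp add: intersection_mult_form_def incident_form_scale second_point_scale
        restrict_poly_scale_form order_smult)
qed

text \<open>The choice of the second point is immaterial.\<close>

lemma second_point_exists:
  assumes "p \<noteq> 0"
  shows "\<exists>q. second_point a p q"
proof (rule ccontr)
  assume "\<not> ?thesis"
  then have *: "\<exists>c. q = c *s p" if "incident_form a q" for q
    using that by (auto simp: second_point_def)
  define u v w :: "complex ^ 3"
    where "u = vector [a $ 2, - a $ 1, 0]" and "v = vector [a $ 3, 0, - a $ 1]"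
      and "w = vector [0, a $ 3, - a $ 2]"
  have "incident_form a u" "incident_form a v" "incident_form a w"
    by (simp_all add: u_def v_def w_def incident_form_def sum_3 vector_3)
  with * obtain x y z where "u = x *s p" "v = y *s p" "w = z *s p" by metis
  then have eqs: "a $ 2 = x * p $ 1" "- a $ 1 = x * p $ 2" "0 = x * p $ 3"
      "a $ 3 = y * p $ 1" "0 = y * p $ 2" "- a $ 1 = y * p $ 3"
      "0 = z * p $ 1" "a $ 3 = z * p $ 2" "- a $ 2 = z * p $ 3"
    by (auto simp: u_def v_def w_def vec_eq_iff forall_3 vector_3)
  have "a = 0"
  proof -
    have "p $ 1 \<noteq> 0 \<or> p $ 2 \<noteq> 0 \<or> p $ 3 \<noteq> 0" using assms by (auto simp: vec_eq_iff forall_3)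
    then show ?thesis using eqs by (auto simp: vec_eq_iff forall_3)
  qed
  then have all: "incident_form a q" for q by (simp add: incident_form_def)
  obtain c1 where c1: "axis 1 1 = c1 *s p" using *[OF all] by blast
  obtain c2 where c2: "axis 2 1 = c2 *s p" using *[OF all] by blast
  have "c1 * p $ 1 = 1" "c1 * p $ 2 = 0" "c2 * p $ 1 = 0" "c2 * p $ 2 = 1"
    using c1 c2 by (auto simp: vec_eq_iff forall_3 axis_def)
  then show False by auto
qed

lemma second_point_unique:
  assumes "a \<noteq> 0" "p \<noteq> 0" "incident_form a p" "second_point a p q" "second_point a p r"
  obtains \<alpha> \<beta> where "\<beta> \<noteq> 0" "r = \<alpha> *s p + \<beta> *s q"
proof -
  have gen: "\<exists>\<alpha> \<beta>. r = \<alpha> *s p + \<beta> *s q"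
    if k: "a $ k \<noteq> 0" and all: "\<And>P. (\<forall>m::3. P m) \<longleftrightarrow> P i \<and> P j \<and> P k"
      and inc: "\<And>x. incident_form a x \<Longrightarrow> a $ i * x $ i + a $ j * x $ j + a $ k * x $ k = 0" for i j k
  proof -
    have ker: "x = y" if "incident_form a x" "incident_form a y" "x $ i = y $ i" "x $ j = y $ j" for x y
    proof -
      have "a $ k * x $ k = a $ k * y $ k"
        using inc[OF that(1)] inc[OF that(2)] that(3,4) by (metis add_left_cancel)
      then show ?thesis using k that(3,4) by (simp add: vec_eq_iff all)
    qed
    have lin: "incident_form a (x *s u + y *s v)" if "incident_form a u" "incident_form a v" for x y u v
    proof -
      have "(\<Sum>i\<in>UNIV. a $ i * (x *s u + y *s v) $ i) =
          x * (\<Sum>i\<in>UNIV. a $ i * u $ i) + y * (\<Sum>i\<in>UNIV. a $ i * v $ i)"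
        by (simp add: sum_distrib_left sum.distrib algebra_simps)
      then show ?thesis using that by (simp add: incident_form_def)
    qed
    have q: "incident_form a q" and r: "incident_form a r" and np: "\<nexists>c. q = c *s p"
      using assms(4,5) by (auto simp: second_point_def)
    define D where "D = p $ i * q $ j - p $ j * q $ i"
    have D: "D \<noteq> 0"
    proof
      assume D0: "D = 0"
      have z: "incident_form a 0" by (simp add: incident_form_def)
      have "p $ i \<noteq> 0 \<or> p $ j \<noteq> 0" using ker[OF assms(3) z] assms(2) by auto
      then obtain c where "q $ i = c * p $ i" "q $ j = c * p $ j"
      proof
        assume "p $ i \<noteq> 0"
        then show ?thesis using D0 by (intro that[of "q $ i / p $ i"]) (auto simp: D_def field_simps)
      next
        assume "p $ j \<noteq> 0"
        then show ?thesis using D0 by (intro that[of "q $ j / p $ j"]) (auto simp: D_def field_simps)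
      qed
      then have "q = c *s p + 0 *s p" by (intro ker q lin assms(3)) auto
      then show False using np by simp
    qed
    define A B where "A = (r $ i * q $ j - r $ j * q $ i) / D" and "B = (p $ i * r $ j - p $ j * r $ i) / D"
    have "D * r $ i = D * (A * p $ i + B * q $ i)" "D * r $ j = D * (A * p $ j + B * q $ j)"
    proof -
      have AB: "D * A = r $ i * q $ j - r $ j * q $ i" "D * B = p $ i * r $ j - p $ j * r $ i"
        using D by (simp_all add: A_def B_def)
      show "D * r $ i = D * (A * p $ i + B * q $ i)"
        unfolding distrib_left mult.assoc[symmetric] AB by (simp add: D_def algebra_simps)
      show "D * r $ j = D * (A * p $ j + B * q $ j)"
        unfolding distrib_left mult.assoc[symmetric] AB by (simp add: D_def algebra_simps)
    qed
    then have "r = A *s p + B *s q" using D by (intro ker r lin assms(3) q) auto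
    then show ?thesis by blast
  qed
  have "a $ 1 \<noteq> 0 \<or> a $ 2 \<noteq> 0 \<or> a $ 3 \<noteq> 0" using assms(1) by (auto simp: vec_eq_iff forall_3)
  then have "\<exists>\<alpha> \<beta>. r = \<alpha> *s p + \<beta> *s q"
  proof (elim disjE)
    assume "a $ 1 \<noteq> 0"
    then show ?thesis
      by (rule gen[of 1 2 3]) (auto simp only: forall_3 incident_form_def sum_3 ac_simps)
  next
    assume "a $ 2 \<noteq> 0"
    then show ?thesis
      by (rule gen[of 2 1 3]) (auto simp only: forall_3 incident_form_def sum_3 ac_simps)
  next
    assume "a $ 3 \<noteq> 0"
    then show ?thesis
      by (rule gen[of 3 1 2]) (auto simp only: forall_3 incident_form_def sum_3 ac_simps)
  qed
  then obtain \<alpha> \<beta> where r: "r = \<alpha> *s p + \<beta> *s q" by blast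
  moreover have "\<beta> \<noteq> 0" using assms(5) r by (auto simp: second_point_def)
  ultimately show ?thesis using that by blast
qed

lemma intersection_mult_form_eq:
  assumes "a \<noteq> 0" "p \<noteq> 0" "incident_form a p" "second_point a p q"
  shows "intersection_mult_form F a p = order 0 (restrict_poly F p q)"
proof -
  have some: "second_point a p (SOME q. second_point a p q)"
    by (rule someI[of "second_point a p", OF assms(4)])
  obtain \<alpha> \<beta> where "\<beta> \<noteq> 0" "(SOME q. second_point a p q) = \<alpha> *s p + \<beta> *s q"
    by (rule second_point_unique[OF assms some])
  then show ?thesis
    using order_restrict_poly_reparam[of 1 \<beta> F p \<alpha> q] assms(3)
    by (simp add: intersection_mult_form_def)
qed

text \<open>The intersection divisor of the line \<open>l\<close> with \<open>F\<close> is \<open>2P + 2Q\<close>, where \<open>P = Q\<close> is allowed.\<close>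

definition bitangent :: "quartic_exp cproj \<Rightarrow> 3 cproj \<Rightarrow> bool"
  where "bitangent F l \<longleftrightarrow>
    (\<exists>P Q. \<forall>R. intersection_mult F l R = (if R = P then 2 else 0) + (if R = Q then 2 else 0))"

section \<open>The bitangent cover\<close>

definition B_btg :: "quartic_exp cproj set"
  where "B_btg = {F. nonsingular F}"

text \<open>The requirement that the bijection is onto all bitangents of \<open>F\<close> encodes that there are
  exactly 28 of them.\<close>

definition E_btg :: "(quartic_exp cproj \<times> (3 cproj ^ 28)) set"
  where "E_btg = {(F, l). F \<in> B_btg \<and> bij_betw (($) l) UNIV {m. bitangent F m}}"

section \<open>Schwarz genus\<close>

text \<open>The value is \<open>\<infinity>\<close> if there is no finite open cover with local sections.\<close>

definition schwarz_genus :: "'e topology \<Rightarrow> 'b topology \<Rightarrow> ('e \<Rightarrow> 'b) \<Rightarrow> enat"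
  where "schwarz_genus E B \<pi> = Inf {enat (card \<U>) | \<U>.
    finite \<U> \<and> (\<forall>U\<in>\<U>. openin B U) \<and> \<Union>\<U> = topspace B \<and>
    (\<forall>U\<in>\<U>. \<exists>s. continuous_map (subtopology B U) E s \<and> (\<forall>x\<in>U. \<pi> (s x) = x))}"

end

theory Submission
  imports Defs "HOL-Library.Z2"
begin

text \<open>
  Let \<open>v\<close>, \<open>w\<close> be nonzero orthogonal vectors of \<open>\<complex>\<^sup>3\<close> and \<open>c\<close> the conjugate of their cross product, all
  regarded as linear forms. The Fermat quartic \<open>v\<^sup>4 + w\<^sup>4 + c\<^sup>4\<close> does not change under sign changes of \<open>v\<close>
  and \<open>w\<close>, whereas its bitangent \<open>v + w + c\<close> takes four different values. A section of the cover over
  \<open>U\<close> assigns to this bitangent a locally constant position in the list of all bitangents, and comparing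
  positions gives locally constant signs that are odd in exactly one of \<open>v\<close> and \<open>w\<close>. From a cover of the
  base by eight such sets one obtains five functions of type (odd, even) and three of type (even, odd)
  without common zero on the orthogonal pairs. Together with the real and the imaginary part of the
  Hermitian product, of type (odd, odd), these are ten functions on \<open>(\<complex>\<^sup>3 - 0)\<^sup>2\<close>, hence on a product
  of two 5-spheres, without common zero.

  That is impossible, because \<open>x\<^sup>5 y\<^sup>3 (x + y)\<^sup>2 = x\<^sup>5 y\<^sup>5\<close> is not zero in the cohomology ring
  \<open>(\<int>/2)[x, y] / (x\<^sup>6, y\<^sup>6)\<close> of a product of two projective 5-spaces. The class is evaluated on a fine grid:
  it is the cup product of the coboundaries of the ten sign functions, and integrating the factors one
  by one reduces the dimension of the grid until a single vertex is left. So in some small simplex each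
  of the ten functions changes sign, and a limit of such simplices is a common zero.
\<close>

section \<open>Cup products of coboundaries on a grid\<close>

text \<open>The library rewrites sums and products of bits to bit operations, out of reach of the ring lemmas.\<close>

declare add_bit_eq_xor [simp del] mult_bit_eq_and [simp del]

lemma bit_add_self: "x + x = (0::bit)"
  by (cases x) (simp_all add: add_bit_eq_xor)

lemma sum_involution_bit:
  fixes f :: "'a \<Rightarrow> bit"
  assumes "finite A" and "\<And>x. x \<in> A \<Longrightarrow> h x \<in> A" "\<And>x. x \<in> A \<Longrightarrow> h (h x) = x"
    "\<And>x. x \<in> A \<Longrightarrow> h x \<noteq> x" "\<And>x. x \<in> A \<Longrightarrow> f (h x) = f x"
  shows "sum f A = 0"
  using assms
proof (induction A rule: finite_psubset_induct)
  case (psubset A)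
  show ?case
  proof (cases "A = {}")
    case False
    then obtain x where x: "x \<in> A" by blast
    let ?B = "A - {x, h x}"
    have inj: "h y \<noteq> x \<and> h y \<noteq> h x" if "y \<in> ?B" for y
      using that psubset.prems(2) x by (metis DiffE insertCI)
    have "sum f ?B = 0"
      by (rule psubset.IH) (use x inj psubset.prems in auto)
    moreover have "sum f A = sum f ?B + sum f {x, h x}"
      using psubset.hyps x psubset.prems(1) by (intro sum.subset_diff) auto
    moreover have "sum f {x, h x} = 0"
      using psubset.prems(3,4)[OF x] by (simp add: bit_add_self)
    ultimately show ?thesis by simp
  qed simp
qed

definition drop_nth :: "nat \<Rightarrow> 'a list \<Rightarrow> 'a list"
  where "drop_nth k vs = take k vs @ drop (Suc k) vs"

lemma drop_nth_0 [simp]: "drop_nth 0 (a # vs) = vs" by (simp add: drop_nth_def)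
lemma drop_nth_Suc [simp]: "drop_nth (Suc k) (a # vs) = a # drop_nth k vs" by (simp add: drop_nth_def)

lemma drop_nth_list_update: "k < length vs \<Longrightarrow> drop_nth k (vs[k := x]) = drop_nth k vs"
  by (simp add: drop_nth_def)

lemma drop_nth_last: "length vs = Suc k \<Longrightarrow> drop_nth k vs = butlast vs"
  by (simp add: drop_nth_def butlast_conv_take)

fun cup_product :: "('a \<Rightarrow> bit) list \<Rightarrow> 'a list \<Rightarrow> bit" where
  "cup_product [] vs = 1"
| "cup_product (s # ss) (a # b # vs) = (s a + s b) * cup_product ss (b # vs)"
| "cup_product (s # ss) vs = 0"

lemma cup_product_coboundary:
  "length vs = length ss + 2 \<Longrightarrow> (\<Sum>k\<le>Suc (length ss). cup_product ss (drop_nth k vs)) = 0"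
proof (induction ss arbitrary: vs)
  case Nil
  then show ?case by (simp add: numeral_2_eq_2)
next
  case (Cons s ss)
  obtain a b c vs' where vs: "vs = a # b # c # vs'"
    using Cons.prems by (cases vs; cases "tl vs"; cases "tl (tl vs)") auto
  let ?D = "\<lambda>k. cup_product ss (drop_nth k (b # c # vs'))"
  have "(\<Sum>k\<le>Suc (length ss). ?D k) = 0"
    using Cons.prems vs by (intro Cons.IH) simp
  then have *: "(\<Sum>k\<le>length ss. ?D (Suc k)) = ?D 0"
    by (subst (asm) sum.atMost_Suc_shift) (metis add.commute add_left_cancel bit_add_self)
  have "(\<Sum>k\<le>Suc (length (s # ss)). cup_product (s # ss) (drop_nth k vs)) =
      (s b + s c) * ?D 0 + (s a + s c) * ?D 0 + (\<Sum>k\<le>length ss. (s a + s b) * ?D (Suc k))"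
    unfolding vs by (simp add: sum.atMost_Suc_shift del: sum.atMost_Suc)
  also have "\<dots> = 0"
    unfolding sum_distrib_left[symmetric] * by (cases "s a"; cases "s b"; cases "s c") (auto simp: bit_add_self)
  finally show ?case .
qed

lemma cup_product_Cons_coboundary:
  assumes "length vs = length ss + 2"
  shows "(\<Sum>k\<le>Suc (length ss). s (hd (drop_nth k vs)) * cup_product ss (drop_nth k vs)) = cup_product (s # ss) vs"
proof -
  obtain a b vs' where vs: "vs = a # b # vs'"
    using assms by (cases vs; cases "tl vs") auto
  have "(\<Sum>k\<le>length ss. cup_product ss (drop_nth (Suc k) vs)) = cup_product ss (drop_nth 0 vs)"
    using cup_product_coboundary[OF assms]
    by (subst (asm) sum.atMost_Suc_shift) (metis add.commute add_left_cancel bit_add_self)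
  then have "(\<Sum>k\<le>Suc (length ss). s (hd (drop_nth k vs)) * cup_product ss (drop_nth k vs)) =
      s b * cup_product ss (drop_nth 0 vs) + s a * cup_product ss (drop_nth 0 vs)"
    unfolding sum.atMost_Suc_shift by (simp add: vs sum_distrib_left[symmetric])
  then show ?thesis by (simp add: vs distrib_right add.commute)
qed

lemma cup_product_map:
  assumes "\<And>s. s \<in> set ss \<Longrightarrow> \<exists>c. \<forall>a\<in>set vs. s (r a) = s a + c"
  shows "cup_product ss (map r vs) = cup_product ss vs"
  using assms
proof (induction ss vs rule: cup_product.induct)
  case (2 s ss a b vs)
  have "s (r a) + s (r b) = s a + s b"
    using "2.prems"[of s] by (auto simp: ac_simps)
  moreover have "cup_product ss (map r (b # vs)) = cup_product ss (b # vs)"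
    using "2.prems" by (intro "2.IH") fastforce
  ultimately show ?case by simp
qed auto

lemma cup_product_eq_0:
  assumes "Suc k < length vs" "k < length ss" "(ss ! k) (vs ! k) = (ss ! k) (vs ! Suc k)"
  shows "cup_product ss vs = 0"
  using assms
proof (induction ss vs arbitrary: k rule: cup_product.induct)
  case (2 s ss a b vs)
  then show ?case by (cases k) auto
qed auto

definition in_grid :: "int \<Rightarrow> nat \<Rightarrow> (nat \<Rightarrow> int) \<Rightarrow> bool"
  where "in_grid N d z \<longleftrightarrow> (\<forall>i<d. \<bar>z i\<bar> \<le> N) \<and> (\<forall>i\<ge>d. z i = N)"

definition grid_step :: "int \<Rightarrow> nat \<Rightarrow> (nat \<Rightarrow> int) \<Rightarrow> (nat \<Rightarrow> int) \<Rightarrow> bool"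
  where "grid_step N d a b \<longleftrightarrow> in_grid N d a \<and> in_grid N d b \<and>
    (\<exists>j<d. even (a j) \<and> \<bar>b j - a j\<bar> = 1 \<and> (\<forall>i. i \<noteq> j \<longrightarrow> b i = a i))"

text \<open>The top-dimensional simplices of a triangulation of the cube \<open>[-N, N]\<^sup>d\<close>, for even \<open>N\<close>: a simplex
  starts at a vertex with even coordinates, and each step makes one more coordinate odd. Unlike the
  usual ordering of the vertices by their coordinates, this one is invariant under reflections. The
  coordinates from \<open>d\<close> on are frozen at \<open>N\<close>, so that a face of the cube is again a cube.\<close>

definition grid_paths :: "int \<Rightarrow> nat \<Rightarrow> (nat \<Rightarrow> int) list set"
  where "grid_paths N d = {vs. length vs = Suc d \<and> in_grid N d (vs ! 0) \<and> (\<forall>i<d. even ((vs ! 0) i)) \<and>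
    (\<forall>k<d. grid_step N d (vs ! k) (vs ! Suc k))}"

lemma finite_in_grid: "finite {z. in_grid N d z}"
proof -
  have "inj_on (\<lambda>z. restrict z {..<d}) {z. in_grid N d z}"
  proof (rule inj_onI, rule ext)
    fix z z' i assume z: "z \<in> {z. in_grid N d z}" "z' \<in> {z. in_grid N d z}"
      and "restrict z {..<d} = restrict z' {..<d}"
    then have "restrict z {..<d} i = restrict z' {..<d} i" by metis
    then show "z i = z' i"
      using z by (cases "i < d") (simp_all add: in_grid_def)
  qed
  moreover have "(\<lambda>z. restrict z {..<d}) ` {z. in_grid N d z} \<subseteq> PiE {..<d} (\<lambda>_. {-N..N})"
    by (auto simp: in_grid_def restrict_def) (meson abs_le_D2 abs_le_iff minus_le_iff)+
  then have "finite ((\<lambda>z. restrict z {..<d}) ` {z. in_grid N d z})"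
    by (rule finite_subset) (simp add: finite_PiE)
  ultimately show ?thesis by (rule inj_on_finite[OF _ subset_refl])
qed

lemma path_in_grid:
  assumes "vs \<in> grid_paths N d" "k \<le> d"
  shows "in_grid N d (vs ! k)"
  using assms by (cases k) (auto simp: grid_paths_def grid_step_def)

lemma finite_grid_paths: "finite (grid_paths N d)"
proof -
  have "grid_paths N d \<subseteq> {vs. set vs \<subseteq> {z. in_grid N d z} \<and> length vs = Suc d}"
  proof
    fix vs assume vs: "vs \<in> grid_paths N d"
    then have "length vs = Suc d" by (simp add: grid_paths_def)
    then show "vs \<in> {vs. set vs \<subseteq> {z. in_grid N d z} \<and> length vs = Suc d}"
      using path_in_grid[OF vs] by (auto simp: in_set_conv_nth)
  qed
  then show ?thesis
    by (rule finite_subset) (rule finite_lists_length_eq[OF finite_in_grid])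
qed

lemma odd_neighbour: "even (a::int) \<Longrightarrow> \<bar>b - a\<bar> = 1 \<Longrightarrow> odd b"
  by presburger

lemma grid_step_even: "grid_step N d a b \<Longrightarrow> even (b j) \<Longrightarrow> a j = b j"
  unfolding grid_step_def by (metis odd_neighbour)

lemma path_even:
  assumes "vs \<in> grid_paths N d" "k \<le> l" "l \<le> d" "even ((vs ! l) j)"
  shows "(vs ! k) j = (vs ! l) j"
  using assms(2,3,4)
proof (induction rule: inc_induct)
  case (step m)
  then have "grid_step N d (vs ! m) (vs ! Suc m)" using assms(1) by (simp add: grid_paths_def)
  then show ?case using step grid_step_even by metis
qed simp

lemma card_even_path:
  assumes "vs \<in> grid_paths N d" "k \<le> d"
  shows "card {i. i < d \<and> even ((vs ! k) i)} = d - k"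
  using assms(2)
proof (induction k)
  case 0
  have "{i. i < d \<and> even ((vs ! 0) i)} = {..<d}" using assms(1) by (auto simp: grid_paths_def)
  then show ?case by simp
next
  case (Suc k)
  then have "grid_step N d (vs ! k) (vs ! Suc k)" using assms(1) by (simp add: grid_paths_def)
  then obtain j where j: "j < d" "even ((vs ! k) j)" "\<bar>(vs ! Suc k) j - (vs ! k) j\<bar> = 1"
    "\<And>i. i \<noteq> j \<Longrightarrow> (vs ! Suc k) i = (vs ! k) i" by (auto simp: grid_step_def)
  have "odd ((vs ! Suc k) j)" using odd_neighbour[OF j(2,3)] .
  then have "{i. i < d \<and> even ((vs ! Suc k) i)} = {i. i < d \<and> even ((vs ! k) i)} - {j}"
    using j by (auto, metis)
  then show ?case using Suc j by simp
qed

lemma path_last_even: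
  assumes "vs \<in> grid_paths N (Suc d)" "i < Suc d" "j < Suc d"
    "even ((vs ! d) i)" "even ((vs ! d) j)"
  shows "i = j"
proof -
  have "card {i. i < Suc d \<and> even ((vs ! d) i)} = 1"
    using card_even_path[OF assms(1), of d] by simp
  then obtain x where "{i. i < Suc d \<and> even ((vs ! d) i)} = {x}"
    by (rule card_1_singletonE)
  then have "i \<in> {x}" "j \<in> {x}" using assms(2-) by blast+
  then show ?thesis by simp
qed

lemma grid_paths_update:
  assumes vs: "vs \<in> grid_paths N d" and k: "k \<le> d"
    and in_grid: "in_grid N d x" and e0: "k = 0 \<Longrightarrow> \<forall>i<d. even (x i)"
    and prev: "0 < k \<Longrightarrow> grid_step N d (vs ! (k - 1)) x"
    and nxt: "k < d \<Longrightarrow> grid_step N d x (vs ! Suc k)"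
  shows "vs[k := x] \<in> grid_paths N d"
proof -
  have len: "length vs = Suc d" using vs by (simp add: grid_paths_def)
  have "grid_step N d (vs[k := x] ! m) (vs[k := x] ! Suc m)" if "m < d" for m
  proof -
    have "grid_step N d (vs ! m) (vs ! Suc m)" using vs that by (simp add: grid_paths_def)
    then show ?thesis using that len prev nxt
      by (cases "m = k"; cases "Suc m = k") auto
  qed
  moreover have "in_grid N d (vs[k := x] ! 0)" "\<forall>i<d. even ((vs[k := x] ! 0) i)"
    using vs in_grid e0 len by (cases "k = 0"; simp add: grid_paths_def)+
  ultimately show ?thesis using len by (simp add: grid_paths_def)
qed

lemma sum_drop_nth_interior:
  assumes k: "0 < k" "k < d"
  shows "(\<Sum>vs\<in>grid_paths N d. f (drop_nth k vs)) = (0::bit)"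
proof (rule sum_involution_bit[OF finite_grid_paths])
  let ?m = "\<lambda>vs::(nat \<Rightarrow> int) list. \<lambda>i. (vs ! (k - 1)) i + (vs ! Suc k) i - (vs ! k) i"
  let ?h = "\<lambda>vs. vs[k := ?m vs]"
  fix vs assume vs: "vs \<in> grid_paths N d"
  then have len: "length vs = Suc d" by (simp add: grid_paths_def)
  define a b c where "a = vs ! (k - 1)" and "b = vs ! k" and "c = vs ! Suc k"
  have "grid_step N d (vs ! (k - 1)) (vs ! Suc (k - 1))" "grid_step N d (vs ! k) (vs ! Suc k)"
    using vs k unfolding grid_paths_def by (simp_all del: Suc_pred Suc_diff_1)
  then have ab: "grid_step N d a b" and bc: "grid_step N d b c" using k by (simp_all add: a_def b_def c_def)
  obtain i where i: "i < d" "even (a i)" "\<bar>b i - a i\<bar> = 1" "\<And>l. l \<noteq> i \<Longrightarrow> b l = a l"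
    using ab by (auto simp: grid_step_def)
  obtain j where j: "j < d" "even (b j)" "\<bar>c j - b j\<bar> = 1" "\<And>l. l \<noteq> j \<Longrightarrow> c l = b l"
    using bc by (auto simp: grid_step_def)
  have ij: "i \<noteq> j" using i(2,3) j(2) odd_neighbour by metis
  define m where "m = ?m vs"
  have m: "m = (\<lambda>l. a l + c l - b l)" by (simp add: m_def a_def b_def c_def)
  have mj: "m j = c j" "m i = a i" "\<And>l. l \<noteq> j \<Longrightarrow> m l = a l" using i j ij by (simp_all add: m)
  have bx: "in_grid N d a" "in_grid N d c" using ab bc by (auto simp: grid_step_def)
  have bm: "in_grid N d m" unfolding in_grid_def
  proof (intro conjI allI impI)
    fix l assume "l < d"
    then show "\<bar>m l\<bar> \<le> N" using bx mj by (cases "l = j") (auto simp: in_grid_def)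
  next
    fix l assume "d \<le> l"
    then show "m l = N" using bx mj by (cases "l = j") (auto simp: in_grid_def)
  qed
  have "grid_step N d a m" unfolding grid_step_def
    using bx bm j mj i(4) ij by (intro conjI exI[of _ j]) auto
  moreover have "grid_step N d m c" unfolding grid_step_def
    using bx bm i mj j ij by (intro conjI exI[of _ i]) (auto, metis mj(1) mj(3))
  ultimately show "?h vs \<in> grid_paths N d"
    using k bm by (intro grid_paths_update[OF vs]) (auto simp: m_def a_def c_def)
  show "?h (?h vs) = vs"
    using k len by (simp add: list_eq_iff_nth_eq nth_list_update)
  show "?h vs \<noteq> vs"
  proof
    assume "?h vs = vs"
    then have "m = b" using k len unfolding m_def b_def by (metis less_SucI nth_list_update_eq)
    then show False using mj i(2,3) by auto
  qed
  show "f (drop_nth k (?h vs)) = f (drop_nth k vs)" using k len by (simp add: drop_nth_list_update)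
qed

lemma sum_drop_nth_first:
  assumes "even N"
  shows "(\<Sum>vs\<in>grid_paths N (Suc d). f (drop_nth 0 vs)) = (0::bit)"
proof (rule sum_involution_bit[OF finite_grid_paths])
  let ?m = "\<lambda>vs::(nat \<Rightarrow> int) list. \<lambda>i. 2 * (vs ! 1) i - (vs ! 0) i"
  let ?h = "\<lambda>vs. vs[0 := ?m vs]"
  fix vs assume vs: "vs \<in> grid_paths N (Suc d)"
  then have len: "length vs = Suc (Suc d)" by (simp add: grid_paths_def)
  define a b where "a = vs ! 0" and "b = vs ! 1"
  have ab: "grid_step N (Suc d) a b" using vs by (auto simp: grid_paths_def a_def b_def)
  obtain i where i: "i < Suc d" "even (a i)" "\<bar>b i - a i\<bar> = 1" "\<And>l. l \<noteq> i \<Longrightarrow> b l = a l"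
    using ab by (auto simp: grid_step_def)
  define m where "m = ?m vs"
  have m: "m = (\<lambda>l. 2 * b l - a l)" by (simp add: m_def a_def b_def)
  have mj: "\<And>l. l \<noteq> i \<Longrightarrow> m l = a l" using i by (simp add: m)
  have bx: "in_grid N (Suc d) a" "in_grid N (Suc d) b" using ab by (auto simp: grid_step_def)
  have "odd (b i)" using odd_neighbour[OF i(2,3)] .
  moreover have "\<bar>b i\<bar> \<le> N" using bx i by (simp add: in_grid_def)
  ultimately have "\<bar>b i\<bar> < N" using assms by presburger
  then have mi: "\<bar>m i\<bar> \<le> N" using i(3) by (simp add: m)
  have bm: "in_grid N (Suc d) m"
    using bx mj mi i(1) unfolding in_grid_def by (metis not_less)
  have em: "even (m l)" if "l < Suc d" for l
    using vs that by (simp add: m grid_paths_def a_def)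
  have "grid_step N (Suc d) m b" unfolding grid_step_def
    using bx bm i mj em by (intro conjI exI[of _ i]) (auto simp: m)
  then show "?h vs \<in> grid_paths N (Suc d)"
    using bm em by (intro grid_paths_update[OF vs]) (auto simp: m_def b_def)
  show "?h (?h vs) = vs"
    using len by (simp add: list_eq_iff_nth_eq nth_list_update)
  show "?h vs \<noteq> vs"
  proof
    assume "?h vs = vs"
    then have "m = a" using len unfolding m_def a_def by (metis zero_less_Suc nth_list_update_eq)
    then have "m i = a i" by simp
    then show False using i(3) by (simp add: m)
  qed
  show "f (drop_nth 0 (?h vs)) = f (drop_nth 0 vs)" using len by (simp add: drop_nth_list_update)
qed

definition boundary_paths :: "int \<Rightarrow> nat \<Rightarrow> nat \<Rightarrow> int \<Rightarrow> (nat \<Rightarrow> int) list set"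
  where "boundary_paths N d j c = {vs \<in> grid_paths N (Suc d). even ((vs ! d) j) \<and> (vs ! d) j = c}"

lemma sum_drop_nth_last:
  assumes N: "even N" "0 < N"
  shows "(\<Sum>vs\<in>grid_paths N (Suc d). f (drop_nth (Suc d) vs)) =
    (\<Sum>j<Suc d. (\<Sum>vs\<in>boundary_paths N d j N. f (butlast vs)) + (\<Sum>vs\<in>boundary_paths N d j (-N). f (butlast vs)) :: bit)"
proof -
  let ?P = "grid_paths N (Suc d)"
  let ?B = "\<lambda>j. boundary_paths N d j N \<union> boundary_paths N d j (-N)"
  let ?m = "\<lambda>vs::(nat \<Rightarrow> int) list. \<lambda>i. 2 * (vs ! d) i - (vs ! Suc d) i"
  let ?h = "\<lambda>vs. vs[Suc d := ?m vs]"
  have bd: "drop_nth (Suc d) vs = butlast vs" if "vs \<in> ?P" for vs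
    using that by (intro drop_nth_last) (simp add: grid_paths_def)
  have sub: "?B j \<subseteq> ?P" for j by (auto simp: boundary_paths_def)
  have fin: "finite (boundary_paths N d j c)" for j c
    using finite_grid_paths by (rule finite_subset[rotated]) (auto simp: boundary_paths_def)
  have "(\<Sum>vs\<in>?P - (\<Union>j<Suc d. ?B j). f (drop_nth (Suc d) vs)) = 0"
  proof (rule sum_involution_bit)
    fix vs assume vs': "vs \<in> ?P - (\<Union>j<Suc d. ?B j)"
    then have vs: "vs \<in> ?P" by blast
    then have len: "length vs = Suc (Suc d)" by (simp add: grid_paths_def)
    define a b where "a = vs ! d" and "b = vs ! Suc d"
    have ab: "grid_step N (Suc d) a b" using vs by (auto simp: grid_paths_def a_def b_def)
    obtain i where i: "i < Suc d" "even (a i)" "\<bar>b i - a i\<bar> = 1" "\<And>l. l \<noteq> i \<Longrightarrow> b l = a l"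
      using ab by (auto simp: grid_step_def)
    define m where "m = ?m vs"
    have m: "m = (\<lambda>l. 2 * a l - b l)" by (simp add: m_def a_def b_def)
    have mj: "\<And>l. l \<noteq> i \<Longrightarrow> m l = a l" using i by (simp add: m)
    have bx: "in_grid N (Suc d) a" "in_grid N (Suc d) b" using ab by (auto simp: grid_step_def)
    have "a i \<noteq> N" "a i \<noteq> -N" using vs' i by (auto simp: boundary_paths_def a_def)
    moreover have "\<bar>a i\<bar> \<le> N" using bx i by (simp add: in_grid_def)
    ultimately have mi: "\<bar>m i\<bar> \<le> N" using i(3) by (simp add: m)
    have bm: "in_grid N (Suc d) m"
      using bx mj mi i(1) unfolding in_grid_def by (metis not_less)
    have "grid_step N (Suc d) a m" unfolding grid_step_def
      using bx bm i mj by (intro conjI exI[of _ i]) (auto simp: m)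
    then have "?h vs \<in> ?P"
      using bm by (intro grid_paths_update[OF vs]) (auto simp: m_def a_def)
    then show "?h vs \<in> ?P - (\<Union>j<Suc d. ?B j)"
      using vs' len by (auto simp: boundary_paths_def nth_list_update)
    show "?h (?h vs) = vs"
      using len by (simp add: list_eq_iff_nth_eq nth_list_update)
    show "?h vs \<noteq> vs"
    proof
      assume "?h vs = vs"
      then have "m = b" using len unfolding m_def b_def by (metis lessI nth_list_update_eq)
      then have "m i = b i" by simp
      then show False using i(3) by (simp add: m)
    qed
    show "f (drop_nth (Suc d) (?h vs)) = f (drop_nth (Suc d) vs)" using len by (simp add: drop_nth_list_update)
  qed (use finite_grid_paths in auto)
  then have "(\<Sum>vs\<in>?P. f (drop_nth (Suc d) vs)) = (\<Sum>vs\<in>(\<Union>j<Suc d. ?B j). f (drop_nth (Suc d) vs))"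
    using sum.subset_diff[of "\<Union>j<Suc d. ?B j" ?P "\<lambda>vs. f (drop_nth (Suc d) vs)"]
      UN_least[of "{..<Suc d}" ?B ?P, OF sub] finite_grid_paths
    by (simp only: add_0)
  also have "\<dots> = (\<Sum>vs\<in>(\<Union>j<Suc d. ?B j). f (butlast vs))"
    using sub by (intro sum.cong refl arg_cong[of _ _ f] bd) blast
  also have "\<dots> = (\<Sum>j<Suc d. \<Sum>vs\<in>?B j. f (butlast vs))"
  proof (rule sum.UNION_disjoint)
    show "\<forall>i\<in>{..<Suc d}. \<forall>j\<in>{..<Suc d}. i \<noteq> j \<longrightarrow> ?B i \<inter> ?B j = {}"
      using path_last_even[of _ N d] by (auto simp: boundary_paths_def)
  qed (use fin in auto)
  also have "\<dots> = (\<Sum>j<Suc d. (\<Sum>vs\<in>boundary_paths N d j N. f (butlast vs)) + (\<Sum>vs\<in>boundary_paths N d j (-N). f (butlast vs)))"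
    using N fin by (intro sum.cong refl sum.union_disjoint) (auto simp: boundary_paths_def)
  finally show ?thesis .
qed

lemma stokes:
  assumes N: "even N" "0 < N" and len: "length ss = d"
  shows "(\<Sum>vs\<in>grid_paths N (Suc d). cup_product (s # ss) vs) =
    (\<Sum>j<Suc d. (\<Sum>vs\<in>boundary_paths N d j N. s (vs ! 0) * cup_product ss (butlast vs)) +
       (\<Sum>vs\<in>boundary_paths N d j (-N). s (vs ! 0) * cup_product ss (butlast vs)))"
proof -
  let ?f = "\<lambda>y. s (hd y) * cup_product ss y"
  have "(\<Sum>vs\<in>grid_paths N (Suc d). cup_product (s # ss) vs) =
      (\<Sum>vs\<in>grid_paths N (Suc d). \<Sum>k\<le>Suc d. ?f (drop_nth k vs))"
    using cup_product_Cons_coboundary[of _ ss s] len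
    by (intro sum.cong refl) (simp add: grid_paths_def del: sum.atMost_Suc)
  also have "\<dots> = (\<Sum>k\<le>Suc d. \<Sum>vs\<in>grid_paths N (Suc d). ?f (drop_nth k vs))"
    by (rule sum.swap)
  also have "\<dots> = (\<Sum>k\<le>d. \<Sum>vs\<in>grid_paths N (Suc d). ?f (drop_nth k vs)) +
      (\<Sum>vs\<in>grid_paths N (Suc d). ?f (drop_nth (Suc d) vs))"
    by simp
  also have "(\<Sum>k\<le>d. \<Sum>vs\<in>grid_paths N (Suc d). ?f (drop_nth k vs)) = 0"
  proof (rule sum.neutral, rule ballI)
    fix k assume "k \<in> {..d}"
    then show "(\<Sum>vs\<in>grid_paths N (Suc d). ?f (drop_nth k vs)) = 0"
      using sum_drop_nth_first[OF N(1), of ?f d] sum_drop_nth_interior[of k "Suc d" ?f N]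
      by (cases "k = 0") auto
  qed
  also have "0 + (\<Sum>vs\<in>grid_paths N (Suc d). ?f (drop_nth (Suc d) vs)) =
    (\<Sum>j<Suc d. (\<Sum>vs\<in>boundary_paths N d j N. ?f (butlast vs)) + (\<Sum>vs\<in>boundary_paths N d j (-N). ?f (butlast vs)))"
    using sum_drop_nth_last[OF N] by simp
  also have "\<dots> = (\<Sum>j<Suc d. (\<Sum>vs\<in>boundary_paths N d j N. s (vs ! 0) * cup_product ss (butlast vs)) +
       (\<Sum>vs\<in>boundary_paths N d j (-N). s (vs ! 0) * cup_product ss (butlast vs)))"
  proof -
    have "hd (butlast vs) = vs ! 0" if "vs \<in> grid_paths N (Suc d)" for vs
      using that by (cases vs; cases "tl vs") (auto simp: grid_paths_def)
    then show ?thesis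
      by (intro sum.cong refl arg_cong2[of _ _ _ _ "(+)"]) (auto simp: boundary_paths_def)
  qed
  finally show ?thesis .
qed

lemma cup_product_boundary_path_degenerate:
  assumes vs: "vs \<in> boundary_paths N d j c" and j: "j < Suc d" "j' < Suc d" "j' \<noteq> j" and len: "length ss = d"
    and const: "\<And>s z x. s \<in> set ss \<Longrightarrow> z j = c \<Longrightarrow> s (z(j' := x)) = s z"
  shows "cup_product ss (butlast vs) = 0"
proof -
  have p: "vs \<in> grid_paths N (Suc d)" and e: "even ((vs ! d) j)" and c: "(vs ! d) j = c"
    using vs unfolding boundary_paths_def by blast+
  have l: "length vs = Suc (Suc d)" using p by (simp add: grid_paths_def)
  have e0: "even ((vs ! 0) j')" using p j by (simp add: grid_paths_def)
  have ed: "odd ((vs ! d) j')" using path_last_even[OF p j(2,1) _ e] j(3) by blast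
  have "\<exists>k<d. even ((vs ! k) j') \<and> odd ((vs ! Suc k) j')"
  proof (rule ccontr)
    assume "\<not> ?thesis"
    then have "even ((vs ! k) j')" if "k \<le> d" for k
      using that e0 by (induction k) auto
    then show False using ed by blast
  qed
  then obtain k where k: "k < d" "even ((vs ! k) j')" "odd ((vs ! Suc k) j')" by blast
  have "grid_step N (Suc d) (vs ! k) (vs ! Suc k)" using p k by (simp add: grid_paths_def)
  then obtain i where i: "\<And>l. l \<noteq> i \<Longrightarrow> (vs ! Suc k) l = (vs ! k) l" by (auto simp: grid_step_def)
  have "i = j'" using i k by metis
  then have upd: "vs ! Suc k = (vs ! k)(j' := (vs ! Suc k) j')"
    using i by (auto simp: fun_eq_iff)
  have "(vs ! k) j = c" using path_even[OF p _ _ e, of k] k c by simp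
  then have "(ss ! k) (vs ! k) = (ss ! k) (vs ! Suc k)"
    using const[of "ss ! k" "vs ! k"] k len upd by (metis nth_mem)
  then show ?thesis
    using k len l by (intro cup_product_eq_0[of k]) (simp_all add: nth_butlast)
qed

definition reflect :: "nat set \<Rightarrow> (nat \<Rightarrow> int) \<Rightarrow> nat \<Rightarrow> int"
  where "reflect A z = (\<lambda>i. if i \<in> A then - z i else z i)"

lemma reflect_reflect [simp]: "reflect A (reflect A z) = z"
  by (simp add: reflect_def fun_eq_iff)

lemma in_grid_reflect: "A \<subseteq> {..<d} \<Longrightarrow> in_grid N d z \<Longrightarrow> in_grid N d (reflect A z)"
  by (auto simp: in_grid_def reflect_def)

lemma grid_step_reflect:
  assumes "A \<subseteq> {..<d}" "grid_step N d a b"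
  shows "grid_step N d (reflect A a) (reflect A b)"
proof -
  obtain j where j: "j < d" "even (a j)" "\<bar>b j - a j\<bar> = 1" "\<And>l. l \<noteq> j \<Longrightarrow> b l = a l"
    using assms(2) by (auto simp: grid_step_def)
  have "\<bar>reflect A b j - reflect A a j\<bar> = 1" using j(3) by (auto simp: reflect_def abs_minus_commute)
  then show ?thesis
    unfolding grid_step_def using assms j
    by (intro conjI exI[of _ j] in_grid_reflect) (auto simp: grid_step_def reflect_def)
qed

lemma map_reflect_boundary_paths:
  assumes A: "A \<subseteq> {..<Suc d}" "j \<in> A" and vs: "vs \<in> boundary_paths N d j c"
  shows "map (reflect A) vs \<in> boundary_paths N d j (- c)"
proof -
  have p: "vs \<in> grid_paths N (Suc d)" using vs by (simp add: boundary_paths_def)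
  then have l: "length vs = Suc (Suc d)" by (simp add: grid_paths_def)
  have "map (reflect A) vs \<in> grid_paths N (Suc d)"
    using p l A grid_step_reflect[OF A(1)] in_grid_reflect[OF A(1)] by (simp add: grid_paths_def reflect_def)
  moreover have "even ((vs ! d) j)" "(vs ! d) j = c" using vs unfolding boundary_paths_def by blast+
  ultimately show ?thesis using l A(2) unfolding boundary_paths_def by (auto simp: reflect_def)
qed

lemma sum_boundary_paths_reflect:
  fixes f :: "(nat \<Rightarrow> int) list \<Rightarrow> bit"
  assumes A: "A \<subseteq> {..<Suc d}" "j \<in> A"
  shows "(\<Sum>vs\<in>boundary_paths N d j (- c). f vs) = (\<Sum>vs\<in>boundary_paths N d j c. f (map (reflect A) vs))"
proof (rule sum.reindex_bij_witness[of _ "map (reflect A)" "map (reflect A)"])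
  fix vs assume "vs \<in> boundary_paths N d j (- c)"
  then show "map (reflect A) vs \<in> boundary_paths N d j c"
    using map_reflect_boundary_paths[OF A, of vs N "- c"] by simp
qed (use map_reflect_boundary_paths[OF A] in \<open>auto simp: comp_def\<close>)

lemma cup_product_reflect_boundary_path:
  assumes vs: "vs \<in> boundary_paths N d j c" and c: "\<bar>c\<bar> = N"
    and ss: "\<And>t. t \<in> set ss \<Longrightarrow> \<exists>a. \<forall>z. \<bar>z j\<bar> = N \<longrightarrow> t (reflect A z) = t z + a"
  shows "cup_product ss (butlast (map (reflect A) vs)) = cup_product ss (butlast vs)"
proof -
  have p: "vs \<in> grid_paths N (Suc d)" and e: "even ((vs ! d) j)" and vd: "(vs ! d) j = c"
    using vs unfolding boundary_paths_def by blast+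
  have l: "length vs = Suc (Suc d)" using p by (simp add: grid_paths_def)
  have "\<bar>z j\<bar> = N" if z: "z \<in> set (butlast vs)" for z
  proof -
    obtain k where k: "k < Suc d" "z = vs ! k"
      using z l by (metis diff_Suc_1 in_set_conv_nth length_butlast nth_butlast)
    then show ?thesis using path_even[OF p _ _ e, of k] vd c by simp
  qed
  then show ?thesis
    unfolding map_butlast[symmetric] using ss by (intro cup_product_map) blast
qed

lemma sum_boundary_paths_butlast:
  fixes f :: "(nat \<Rightarrow> int) list \<Rightarrow> bit"
  assumes N: "even N" "0 < N"
  shows "(\<Sum>vs\<in>boundary_paths N d d N. f (butlast vs)) = (\<Sum>vs\<in>grid_paths N d. f vs)"
proof (rule sum.reindex_bij_witness[of _ "\<lambda>vs. vs @ [(last vs)(d := N - 1)]" butlast])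
  fix vs assume vs: "vs \<in> boundary_paths N d d N"
  then have p: "vs \<in> grid_paths N (Suc d)" and e: "even ((vs ! d) d)" and vd: "(vs ! d) d = N"
    unfolding boundary_paths_def by blast+
  have l: "length vs = Suc (Suc d)" using p by (simp add: grid_paths_def)
  have const: "(vs ! k) d = N" if "k \<le> d" for k
    using path_even[OF p _ _ e, of k] vd that by simp
  have b: "in_grid N d (vs ! k)" if "k \<le> d" for k
  proof -
    have "in_grid N (Suc d) (vs ! k)" using path_in_grid[OF p] that by simp
    moreover have "(vs ! k) i = N" if "d \<le> i" "\<forall>i\<ge>Suc d. (vs ! k) i = N" for i
      using that const[OF \<open>k \<le> d\<close>] by (cases "i = d") auto
    ultimately show ?thesis by (simp add: in_grid_def)
  qed
  have st: "grid_step N (Suc d) (vs ! k) (vs ! Suc k)" if "k < Suc d" for k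
    using p that by (simp add: grid_paths_def)
  have "grid_step N d (vs ! k) (vs ! Suc k)" if k: "k < d" for k
  proof -
    obtain j where j: "j < Suc d" "even ((vs ! k) j)" "\<bar>(vs ! Suc k) j - (vs ! k) j\<bar> = 1"
      "\<And>l. l \<noteq> j \<Longrightarrow> (vs ! Suc k) l = (vs ! k) l" using st[of k] k by (auto simp: grid_step_def)
    moreover have "j \<noteq> d" using j(3) const[of k] const[of "Suc k"] that by auto
    ultimately show ?thesis unfolding grid_step_def using b[of k] b[of "Suc k"] that
      by (intro conjI exI[of _ j]) auto
  qed
  then show "butlast vs \<in> grid_paths N d"
    using l b[of 0] p by (simp add: grid_paths_def nth_butlast)
  obtain j where j: "j < Suc d" "even ((vs ! d) j)" "\<bar>(vs ! Suc d) j - (vs ! d) j\<bar> = 1"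
    "\<And>l. l \<noteq> j \<Longrightarrow> (vs ! Suc d) l = (vs ! d) l" using st[of d] by (auto simp: grid_step_def)
  have "j = d" using path_last_even[OF p j(1) lessI j(2) e] .
  moreover have "\<bar>(vs ! Suc d) d\<bar> \<le> N" using path_in_grid[OF p, of "Suc d"] by (simp add: in_grid_def)
  ultimately have "vs ! Suc d = (vs ! d)(d := N - 1)" using j vd by (auto simp: fun_eq_iff)
  moreover have "last (butlast vs) = vs ! d" "last vs = vs ! Suc d"
    using l by (simp_all add: last_conv_nth nth_butlast flip: length_0_conv)
  moreover have "butlast vs @ [last vs] = vs" using l by (intro append_butlast_last_id) auto
  ultimately show "butlast vs @ [(last (butlast vs))(d := N - 1)] = vs" by simp
next
  fix vs assume vs: "vs \<in> grid_paths N d"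
  have l: "length vs = Suc d" using vs by (simp add: grid_paths_def)
  have bS: "in_grid N (Suc d) z" if "in_grid N d z" for z
    using that N by (auto simp: in_grid_def less_Suc_eq)
  have bN: "(vs ! k) d = N" if "k \<le> d" for k
    using path_in_grid[OF vs that] by (simp add: in_grid_def)
  let ?b = "(last vs)(d := N - 1)"
  have la: "last vs = vs ! d" using l by (simp add: last_conv_nth flip: length_0_conv)
  have "in_grid N (Suc d) ?b"
    using bS[OF path_in_grid[OF vs order_refl]] N by (auto simp: in_grid_def la)
  then have "grid_step N (Suc d) (vs ! d) ?b"
    unfolding grid_step_def using bS[OF path_in_grid[OF vs order_refl]] bN N
    by (intro conjI exI[of _ d]) (auto simp: la)
  moreover have "grid_step N (Suc d) (vs ! k) (vs ! Suc k)" if "k < d" for k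
  proof -
    have "grid_step N d (vs ! k) (vs ! Suc k)" using vs that by (simp add: grid_paths_def)
    then show ?thesis using bS by (auto simp: grid_step_def less_Suc_eq)
  qed
  ultimately have st: "grid_step N (Suc d) ((vs @ [?b]) ! k) ((vs @ [?b]) ! Suc k)" if "k < Suc d" for k
    using that l by (cases "k = d") (auto simp: nth_append less_Suc_eq)
  have "even ((vs ! 0) i)" if "i < Suc d" for i
    using that vs bN[of 0] N by (cases "i = d") (auto simp: grid_paths_def)
  then have "vs @ [?b] \<in> grid_paths N (Suc d)"
    using st l bS[OF path_in_grid[OF vs, of 0]] by (auto simp: grid_paths_def nth_append)
  then show "vs @ [?b] \<in> boundary_paths N d d N"
    using l bN[of d] N by (simp add: boundary_paths_def nth_append)
qed simp_all

text \<open>Integrating the first coboundary leaves the faces of the cube. The two faces in direction \<open>d\<close> are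
  exchanged by a reflection that changes \<open>s\<close> by one, so together they contribute the sum without \<open>s\<close>;
  the hypothesis \<open>side\<close> makes all other faces degenerate or cancel in pairs.\<close>

lemma sum_cup_reduce:
  assumes N: "even N" "0 < N" and len: "length ss = d"
    and A: "A \<subseteq> {..<Suc d}" "d \<in> A"
    and flip: "\<And>z. \<bar>z d\<bar> = N \<Longrightarrow> s (reflect A z) = s z + 1"
      "\<And>t. t \<in> set ss \<Longrightarrow> \<exists>a. \<forall>z. \<bar>z d\<bar> = N \<longrightarrow> t (reflect A z) = t z + a"
    and side: "\<And>j. j < d \<Longrightarrow>
      (\<exists>j'<Suc d. j' \<noteq> j \<and> (\<forall>t\<in>set ss. \<forall>z x. \<bar>z j\<bar> = N \<longrightarrow> t (z(j' := x)) = t z)) \<or>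
      (\<exists>B\<subseteq>{..<Suc d}. j \<in> B \<and> (\<forall>z. \<bar>z j\<bar> = N \<longrightarrow> s (reflect B z) = s z) \<and>
        (\<forall>t\<in>set ss. \<exists>a. \<forall>z. \<bar>z j\<bar> = N \<longrightarrow> t (reflect B z) = t z + a))"
  shows "(\<Sum>vs\<in>grid_paths N (Suc d). cup_product (s # ss) vs) = (\<Sum>vs\<in>grid_paths N d. cup_product ss vs)"
proof -
  let ?f = "\<lambda>vs. s (vs ! 0) * cup_product ss (butlast vs)"
  have v0: "\<bar>(vs ! 0) j\<bar> = N" "length vs = Suc (Suc d)" if "vs \<in> boundary_paths N d j N" for vs j
    using that path_even[of vs N "Suc d" 0 d j] N(2) by (auto simp: boundary_paths_def grid_paths_def)
  have zero: "(\<Sum>vs\<in>boundary_paths N d j N. ?f vs) + (\<Sum>vs\<in>boundary_paths N d j (-N). ?f vs) = 0" if j: "j < d" for j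
    using side[OF j]
  proof (elim disjE exE conjE)
    fix j' assume j': "j' < Suc d" "j' \<noteq> j"
      "\<forall>t\<in>set ss. \<forall>z x. \<bar>z j\<bar> = N \<longrightarrow> t (z(j' := x)) = t z"
    have "cup_product ss (butlast vs) = 0" if "vs \<in> boundary_paths N d j c" "\<bar>c\<bar> = N" for vs c
      using that j' j len by (intro cup_product_boundary_path_degenerate[of vs N d j c j']) auto
    then show ?thesis using N(2) by (auto intro!: sum.neutral simp del: sum_mult_of_bool_eq)
  next
    fix B assume B: "B \<subseteq> {..<Suc d}" "j \<in> B" "\<forall>z. \<bar>z j\<bar> = N \<longrightarrow> s (reflect B z) = s z"
      "\<forall>t\<in>set ss. \<exists>a. \<forall>z. \<bar>z j\<bar> = N \<longrightarrow> t (reflect B z) = t z + a"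
    have "(\<Sum>vs\<in>boundary_paths N d j (-N). ?f vs) = (\<Sum>vs\<in>boundary_paths N d j N. ?f (map (reflect B) vs))"
      by (rule sum_boundary_paths_reflect[OF B(1,2)])
    also have "\<dots> = (\<Sum>vs\<in>boundary_paths N d j N. ?f vs)"
    proof (rule sum.cong[OF HOL.refl])
      fix vs assume vs: "vs \<in> boundary_paths N d j N"
      have "cup_product ss (butlast (map (reflect B) vs)) = cup_product ss (butlast vs)"
        using B(4) N(2) by (intro cup_product_reflect_boundary_path[OF vs]) auto
      moreover have "s (map (reflect B) vs ! 0) = s (vs ! 0)" using v0[OF vs] B(3) by simp
      ultimately show "?f (map (reflect B) vs) = ?f vs" by simp
    qed
    finally show ?thesis by (simp add: bit_add_self)
  qed
  have "(\<Sum>vs\<in>boundary_paths N d d (-N). ?f vs) = (\<Sum>vs\<in>boundary_paths N d d N. ?f (map (reflect A) vs))"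
    by (rule sum_boundary_paths_reflect[OF A])
  also have "\<dots> = (\<Sum>vs\<in>boundary_paths N d d N. ?f vs + cup_product ss (butlast vs))"
  proof (rule sum.cong[OF HOL.refl])
    fix vs assume vs: "vs \<in> boundary_paths N d d N"
    have "cup_product ss (butlast (map (reflect A) vs)) = cup_product ss (butlast vs)"
      using flip(2) N(2) by (intro cup_product_reflect_boundary_path[OF vs]) auto
    moreover have "s (map (reflect A) vs ! 0) = s (vs ! 0) + 1" using v0[OF vs] flip(1) by simp
    ultimately show "?f (map (reflect A) vs) = ?f vs + cup_product ss (butlast vs)"
      by (simp add: distrib_right)
  qed
  finally have "(\<Sum>vs\<in>boundary_paths N d d N. ?f vs) + (\<Sum>vs\<in>boundary_paths N d d (-N). ?f vs) =
      (\<Sum>vs\<in>boundary_paths N d d N. cup_product ss (butlast vs))"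
    by (simp only: sum.distrib add.assoc[symmetric] bit_add_self add_0)
  also have "\<dots> = (\<Sum>vs\<in>grid_paths N d. cup_product ss vs)" by (rule sum_boundary_paths_butlast[OF N])
  finally show ?thesis
    unfolding stokes[OF N len] using zero by (simp only: sum.lessThan_Suc) simp
qed

text \<open>The sign functions on a product of two spheres, pulled back to the cube: the coordinates below \<open>n\<close>
  parametrise a hemisphere of the second factor, the others one of the first, and \<open>a\<close>, \<open>b\<close> are the
  parities of \<open>s\<close> in the first and in the second factor.\<close>

definition admissible :: "int \<Rightarrow> nat \<Rightarrow> nat \<Rightarrow> bit \<Rightarrow> bit \<Rightarrow> ((nat \<Rightarrow> int) \<Rightarrow> bit) \<Rightarrow> bool"
  where "admissible N n M a b s \<longleftrightarrow>
    (\<forall>j j' z x. \<bar>z j\<bar> = N \<and> j < j' \<and> j' < M \<and> (j' < n \<or> n \<le> j) \<longrightarrow> s (z(j' := x)) = s z) \<and>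
    (\<forall>j z. \<bar>z j\<bar> = N \<and> n \<le> j \<and> j < M \<longrightarrow> s (reflect {n..j} z) = s z + a) \<and>
    (\<forall>j z. \<bar>z j\<bar> = N \<and> j < n \<longrightarrow> s (reflect {..j} z) = s z + b)"

lemma sum_cup_lower:
  assumes N: "even N" "0 < N" and "d \<le> n" "n \<le> M" "length ss = d"
    "\<And>s. s \<in> set ss \<Longrightarrow> \<exists>a. admissible N n M a 1 s"
  shows "(\<Sum>vs\<in>grid_paths N d. cup_product ss vs) = 1"
  using assms(3-)
proof (induction d arbitrary: ss)
  case 0
  have "grid_paths N 0 = {[\<lambda>_. N]}"
    by (auto simp: grid_paths_def in_grid_def length_Suc_conv fun_eq_iff)
  then show ?case using 0 by simp
next
  case (Suc d)
  then obtain s ss' where ss: "ss = s # ss'" "length ss' = d" by (auto simp: length_Suc_conv)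
  have ad: "\<exists>a. admissible N n M a 1 t" if "t \<in> set ss" for t using Suc.prems that by blast
  have "(\<Sum>vs\<in>grid_paths N (Suc d). cup_product (s # ss') vs) = (\<Sum>vs\<in>grid_paths N d. cup_product ss' vs)"
  proof (rule sum_cup_reduce[OF N ss(2), of "{..d}"])
    show "s (reflect {..d} z) = s z + 1" if "\<bar>z d\<bar> = N" for z
      using that ad[of s] Suc.prems ss by (auto simp: admissible_def)
    show "\<exists>a. \<forall>z. \<bar>z d\<bar> = N \<longrightarrow> t (reflect {..d} z) = t z + a" if t: "t \<in> set ss'" for t
    proof -
      obtain a where "admissible N n M a 1 t" using t ad[of t] ss by auto
      then show ?thesis using Suc.prems unfolding admissible_def by (intro exI[of _ 1]) simp
    qed
    fix j assume j: "j < d"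
    have "t (z(d := x)) = t z" if t: "t \<in> set ss'" "\<bar>z j\<bar> = N" for t z x
    proof -
      obtain a where "admissible N n M a 1 t" using t ad[of t] ss by auto
      then show ?thesis using t(2) j Suc.prems unfolding admissible_def
        by (metis less_le_trans lessI)
    qed
    then show "(\<exists>j'<Suc d. j' \<noteq> j \<and> (\<forall>t\<in>set ss'. \<forall>z x. \<bar>z j\<bar> = N \<longrightarrow> t (z(j' := x)) = t z)) \<or>
      (\<exists>B\<subseteq>{..<Suc d}. j \<in> B \<and> (\<forall>z. \<bar>z j\<bar> = N \<longrightarrow> s (reflect B z) = s z) \<and>
        (\<forall>t\<in>set ss'. \<exists>a. \<forall>z. \<bar>z j\<bar> = N \<longrightarrow> t (reflect B z) = t z + a))"
      using j by (intro disjI1 exI[of _ d]) auto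
  qed auto
  also have "\<dots> = 1" using Suc ss by (intro Suc.IH) auto
  finally show ?case using ss by simp
qed

lemma sum_cup_odd:
  assumes N: "even N" "0 < N" and "n + m \<le> M" "length xs = m" "length ys = n"
    "\<And>s. s \<in> set xs \<Longrightarrow> admissible N n M 1 0 s"
    "\<And>s. s \<in> set ys \<Longrightarrow> \<exists>a. admissible N n M a 1 s"
  shows "(\<Sum>vs\<in>grid_paths N (n + m). cup_product (xs @ ys) vs) = 1"
  using assms(3-)
proof (induction m arbitrary: xs)
  case 0
  then show ?case using sum_cup_lower[OF N, of n n M ys] by simp
next
  case (Suc m)
  then obtain s xs' where xs: "xs = s # xs'" "length xs' = m" by (auto simp: length_Suc_conv)
  let ?d = "n + m"
  have ad: "\<exists>a b. admissible N n M a b t" if "t \<in> set (xs' @ ys)" for t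
    using Suc.prems(4)[of t] Suc.prems(5)[of t] that xs by auto
  have s: "admissible N n M 1 0 s" using Suc.prems xs by simp
  have dM: "?d < M" using Suc.prems by simp
  have "(\<Sum>vs\<in>grid_paths N (Suc ?d). cup_product (s # (xs' @ ys)) vs) = (\<Sum>vs\<in>grid_paths N ?d. cup_product (xs' @ ys) vs)"
  proof (rule sum_cup_reduce[OF N, of _ _ "{n..?d}"])
    show "s (reflect {n..?d} z) = s z + 1" if "\<bar>z ?d\<bar> = N" for z
      using that s dM by (auto simp: admissible_def)
    show "\<exists>a. \<forall>z. \<bar>z ?d\<bar> = N \<longrightarrow> t (reflect {n..?d} z) = t z + a" if t: "t \<in> set (xs' @ ys)" for t
    proof -
      obtain a b where "admissible N n M a b t" using t ad by blast
      then show ?thesis using dM unfolding admissible_def by (intro exI[of _ a]) simp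
    qed
    fix j assume j: "j < ?d"
    have degen: "t (z(j' := x)) = t z" if t: "t \<in> set (xs' @ ys)" "\<bar>z j\<bar> = N" "j < j'" "j' < M" "j' < n \<or> n \<le> j"
      for t z x j'
    proof -
      obtain a b where "admissible N n M a b t" using t ad[of t] by auto
      then show ?thesis using t(2-) unfolding admissible_def by metis
    qed
    show "(\<exists>j'<Suc ?d. j' \<noteq> j \<and> (\<forall>t\<in>set (xs' @ ys). \<forall>z x. \<bar>z j\<bar> = N \<longrightarrow> t (z(j' := x)) = t z)) \<or>
      (\<exists>B\<subseteq>{..<Suc ?d}. j \<in> B \<and> (\<forall>z. \<bar>z j\<bar> = N \<longrightarrow> s (reflect B z) = s z) \<and>
        (\<forall>t\<in>set (xs' @ ys). \<exists>a. \<forall>z. \<bar>z j\<bar> = N \<longrightarrow> t (reflect B z) = t z + a))" (is "?L \<or> ?R")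
    proof (cases "n \<le> j \<or> Suc j < n")
      case True
      then have ?L
      proof
        assume "n \<le> j"
        then show ?L using j dM by (intro exI[of _ ?d]) (auto intro!: degen)
      next
        assume "Suc j < n"
        then show ?L using dM by (intro exI[of _ "Suc j"]) (auto intro!: degen)
      qed
      then show ?thesis by blast
    next
      case False
      then have jn: "j < n" by simp
      have "\<exists>a. \<forall>z. \<bar>z j\<bar> = N \<longrightarrow> t (reflect {..j} z) = t z + a" if t: "t \<in> set (xs' @ ys)" for t
      proof -
        obtain a b where "admissible N n M a b t" using t ad by blast
        then show ?thesis using jn unfolding admissible_def by (intro exI[of _ b]) simp
      qed
      moreover have "s (reflect {..j} z) = s z" if "\<bar>z j\<bar> = N" for z
        using that s jn by (auto simp: admissible_def)
      ultimately have ?R using j by (intro exI[of _ "{..j}"]) auto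
      then show ?thesis by blast
    qed
  qed (use Suc.prems xs in auto)
  also have "\<dots> = 1" using Suc xs by (intro Suc.IH) auto
  finally show ?case using xs by simp
qed

lemma exists_alternating_path:
  assumes "even N" "0 < N" "length xs = m" "length ys = n"
    "\<And>s. s \<in> set xs \<Longrightarrow> admissible N n (n + m) 1 0 s"
    "\<And>s. s \<in> set ys \<Longrightarrow> \<exists>a. admissible N n (n + m) a 1 s"
  obtains vs where "vs \<in> grid_paths N (n + m)"
    "\<And>i. i < n + m \<Longrightarrow> ((xs @ ys) ! i) (vs ! i) \<noteq> ((xs @ ys) ! i) (vs ! Suc i)"
proof -
  have "(\<Sum>vs\<in>grid_paths N (n + m). cup_product (xs @ ys) vs) \<noteq> 0"
    using sum_cup_odd[of N n m "n + m" xs ys] assms by simp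
  then obtain vs where vs: "vs \<in> grid_paths N (n + m)" "cup_product (xs @ ys) vs \<noteq> 0"
    by (meson sum.neutral)
  show ?thesis
  proof (rule that[OF vs(1)])
    fix i assume "i < n + m"
    then show "((xs @ ys) ! i) (vs ! i) \<noteq> ((xs @ ys) ! i) (vs ! Suc i)"
      using vs cup_product_eq_0[of i vs "xs @ ys"] assms(3,4) by (auto simp: grid_paths_def)
  qed
qed

lemma path_dist:
  assumes vs: "vs \<in> grid_paths N d" and k: "k \<le> d"
  shows "\<bar>(vs ! k) i - (vs ! 0) i\<bar> \<le> 1"
proof -
  have "(vs ! k) i = (vs ! 0) i \<or> (odd ((vs ! k) i) \<and> \<bar>(vs ! k) i - (vs ! 0) i\<bar> = 1)"
    using k
  proof (induction k)
    case (Suc k)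
    then have "grid_step N d (vs ! k) (vs ! Suc k)" using vs by (simp add: grid_paths_def)
    then obtain j where j: "even ((vs ! k) j)" "\<bar>(vs ! Suc k) j - (vs ! k) j\<bar> = 1"
      "\<And>l. l \<noteq> j \<Longrightarrow> (vs ! Suc k) l = (vs ! k) l" by (auto simp: grid_step_def)
    show ?case
    proof (cases "i = j")
      case True
      then have "(vs ! k) i = (vs ! 0) i" using Suc j(1) by auto
      then show ?thesis using j odd_neighbour[OF j(1,2)] True by simp
    next
      case False
      then show ?thesis using Suc j(3) by simp
    qed
  qed simp
  then show ?thesis by auto
qed

section \<open>A Borsuk-Ulam theorem for products of spheres\<close>

text \<open>Spherical coordinates of a hemisphere with \<open>cos\<close> and \<open>sin\<close> replaced by \<open>t\<close> and \<open>1 - t\<^sup>2\<close>; the point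
  need not have norm one. At \<open>t j = \<plusminus> 1\<close> the parameters after \<open>j\<close> become irrelevant.\<close>

definition hemi :: "nat \<Rightarrow> (nat \<Rightarrow> real) \<Rightarrow> nat \<Rightarrow> real"
  where "hemi n t k = (\<Prod>i<k. 1 - (t i)\<^sup>2) * (if k < n then t k else 1)"

lemma hemi_nonzero: "\<exists>k\<le>n. hemi n t k \<noteq> 0"
proof (rule ccontr)
  assume "\<not> ?thesis"
  then have z: "hemi n t k = 0" if "k \<le> n" for k using that by blast
  have "k \<le> n \<Longrightarrow> (\<Prod>i<k. 1 - (t i)\<^sup>2) = 1" for k
  proof (induction k)
    case (Suc k)
    then show ?case using z[of k] by (simp add: hemi_def)
  qed simp
  then show False using z[of n] by (simp add: hemi_def)
qed

lemma hemi_cong: "(\<And>i. i < n \<Longrightarrow> t i = t' i) \<Longrightarrow> k \<le> n \<Longrightarrow> hemi n t k = hemi n t' k"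
  unfolding hemi_def by (intro arg_cong2[of _ _ _ _ "(*)"] prod.cong) auto

lemma hemi_eq_0: "(t j)\<^sup>2 = 1 \<Longrightarrow> j < k \<Longrightarrow> hemi n t k = 0"
  unfolding hemi_def by (subst prod_zero) (auto intro!: bexI[of _ j])

lemma hemi_degenerate:
  assumes "(t j)\<^sup>2 = 1" "j < j'"
  shows "hemi n (t(j' := x)) k = hemi n t k"
proof (cases "k < j'")
  case True
  then show ?thesis unfolding hemi_def by (intro arg_cong2[of _ _ _ _ "(*)"] prod.cong) auto
next
  case False
  then show ?thesis using assms hemi_eq_0[of t j k n] hemi_eq_0[of "t(j' := x)" j k n] by simp
qed

lemma hemi_antipodal:
  assumes "(t j)\<^sup>2 = 1" "j < n"
  shows "hemi n (\<lambda>i. if i \<le> j then - t i else t i) k = - hemi n t k"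
proof (cases "k \<le> j")
  case True
  then have "(\<Prod>i<k. 1 - (if i \<le> j then - t i else t i)\<^sup>2) = (\<Prod>i<k. 1 - (t i)\<^sup>2)"
    by (intro prod.cong) auto
  then show ?thesis using True assms(2) by (simp add: hemi_def)
next
  case False
  then show ?thesis using assms(1) hemi_eq_0[of t j k n]
      hemi_eq_0[of "\<lambda>i. if i \<le> j then - t i else t i" j k n] by simp
qed

definition emb :: "(nat \<Rightarrow> real) \<Rightarrow> complex ^ 3"
  where "emb t = vector [Complex (hemi 5 t 0) (hemi 5 t 1), Complex (hemi 5 t 2) (hemi 5 t 3),
    Complex (hemi 5 t 4) (hemi 5 t 5)]"

lemma emb_nonzero: "emb t \<noteq> 0"
proof
  assume "emb t = 0"
  then have "hemi 5 t k = 0" if "k \<in> {0,1,2,3,4,5}" for k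
    using that by (auto simp: emb_def vec_eq_iff forall_3 vector_3 complex_eq_iff)
  moreover obtain k where "k \<le> 5" "hemi 5 t k \<noteq> 0" using hemi_nonzero by blast
  moreover have "k \<le> 5 \<Longrightarrow> k \<in> {0,1,2,3,4,5}" for k :: nat by auto
  ultimately show False by blast
qed

lemma emb_cong: "(\<And>i. i < 5 \<Longrightarrow> t i = t' i) \<Longrightarrow> emb t = emb t'"
  unfolding emb_def using hemi_cong[of 5 t t'] by simp

lemma emb_degenerate: "(t j)\<^sup>2 = 1 \<Longrightarrow> j < j' \<Longrightarrow> emb (t(j' := x)) = emb t"
  unfolding emb_def by (simp only: hemi_degenerate)

lemma emb_antipodal:
  assumes "(t j)\<^sup>2 = 1" "j < 5"
  shows "emb (\<lambda>i. if i \<le> j then - t i else t i) = - emb t"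
  unfolding emb_def hemi_antipodal[where t = t and j = j, OF assms]
  by (simp add: vec_eq_iff forall_3 vector_3 complex_eq_iff)

lemma tendsto_emb:
  assumes "\<And>i. (\<lambda>n. t n i) \<longlonglongrightarrow> t' i"
  shows "(\<lambda>n. emb (t n)) \<longlonglongrightarrow> emb t'"
proof -
  have h: "(\<lambda>n. hemi 5 (t n) k) \<longlonglongrightarrow> hemi 5 t' k" for k
    unfolding hemi_def using assms by (cases "k < 5") (auto intro!: tendsto_intros)
  show ?thesis
  proof (rule vec_tendstoI)
    fix i :: 3
    show "(\<lambda>n. emb (t n) $ i) \<longlonglongrightarrow> emb t' $ i"
      using exhaust_3[of i] by (auto simp: emb_def vector_3 intro!: tendsto_Complex h)
  qed
qed

lemma exists_odd_predicate:
  obtains L :: "'a::real_vector \<Rightarrow> bool" where "\<And>v. v \<noteq> 0 \<Longrightarrow> L (- v) \<longleftrightarrow> \<not> L v"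
proof
  define L where "L v \<longleftrightarrow> (v :: 'a) = (SOME u. u \<in> {v, - v})" for v
  fix v :: 'a assume v: "v \<noteq> 0"
  have "(SOME u. u \<in> {v, - v}) \<in> {v, - v}" by (rule someI[of _ v]) simp
  moreover have "{- v, - (- v)} = {v, - v}" by auto
  moreover have "v \<noteq> - v" using v by (metis add.inverse_unique add_eq_0_iff real_vector.scale_left_distrib one_add_one scaleR_half_double scaleR_zero_right)
  ultimately show "L (- v) \<longleftrightarrow> \<not> L v" unfolding L_def by (metis empty_iff insert_iff)
qed

lemma admissible_emb:
  fixes S :: "(complex ^ 3) \<times> (complex ^ 3) \<Rightarrow> bit"
  assumes N: "0 < N"
    and a: "\<And>v w. v \<noteq> 0 \<Longrightarrow> w \<noteq> 0 \<Longrightarrow> S (- v, w) = S (v, w) + a"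
    and b: "\<And>v w. v \<noteq> 0 \<Longrightarrow> w \<noteq> 0 \<Longrightarrow> S (v, - w) = S (v, w) + b"
  shows "admissible N 5 10 a b (\<lambda>z. S (emb (\<lambda>i. of_int (z (i + 5)) / of_int N), emb (\<lambda>i. of_int (z i) / of_int N)))"
    (is "admissible N 5 10 a b (\<lambda>z. S (?V z, ?W z))")
proof -
  have sq: "(of_int x / of_int N :: real)\<^sup>2 = 1" if "\<bar>x\<bar> = N" for x :: int
    using that N by (auto simp: abs_if power_divide split: if_splits)
  have "?V (z(j' := x)) = ?V z \<and> ?W (z(j' := x)) = ?W z"
    if j: "\<bar>z j\<bar> = N" "j < j'" "j' < 10" "j' < 5 \<or> 5 \<le> j" for z j j' x
  proof (cases "j' < 5")
    case True
    have "?W (z(j' := x)) = emb ((\<lambda>i. of_int (z i) / of_int N)(j' := of_int x / of_int N))"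
      by (rule emb_cong) auto
    also have "\<dots> = ?W z"
      using sq[OF j(1)] j(2) by (intro emb_degenerate[where j = j]) auto
    finally show ?thesis using True by (auto intro!: emb_cong)
  next
    case False
    then have "5 \<le> j" using j by simp
    have "?V (z(j' := x)) = emb ((\<lambda>i. of_int (z (i + 5)) / of_int N)(j' - 5 := of_int x / of_int N))"
      using False by (intro emb_cong) auto
    also have "\<dots> = ?V z"
      using sq[OF j(1)] j(2) \<open>5 \<le> j\<close> by (intro emb_degenerate[where j = "j - 5"]) auto
    finally show ?thesis using False by (auto intro!: emb_cong)
  qed
  moreover have "S (?V (reflect {5..j} z), ?W (reflect {5..j} z)) = S (?V z, ?W z) + a"
    if j: "\<bar>z j\<bar> = N" "5 \<le> j" "j < 10" for z j
  proof -
    have "?V (reflect {5..j} z) = emb (\<lambda>i. if i \<le> j - 5 then - (of_int (z (i + 5)) / of_int N) else of_int (z (i + 5)) / of_int N)"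
      using j by (intro emb_cong) (auto simp: reflect_def)
    also have "\<dots> = - ?V z"
      using sq[OF j(1)] j by (intro emb_antipodal) auto
    finally have "?V (reflect {5..j} z) = - ?V z" .
    moreover have "?W (reflect {5..j} z) = ?W z" by (rule emb_cong) (auto simp: reflect_def)
    ultimately show ?thesis using a emb_nonzero by simp
  qed
  moreover have "S (?V (reflect {..j} z), ?W (reflect {..j} z)) = S (?V z, ?W z) + b"
    if j: "\<bar>z j\<bar> = N" "j < 5" for z j
  proof -
    have "?W (reflect {..j} z) = emb (\<lambda>i. if i \<le> j then - (of_int (z i) / of_int N) else of_int (z i) / of_int N)"
      by (intro emb_cong) (auto simp: reflect_def)
    also have "\<dots> = - ?W z"
      using sq[OF j(1)] j by (intro emb_antipodal) auto
    finally have "?W (reflect {..j} z) = - ?W z" .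
    moreover have "?V (reflect {..j} z) = ?V z" using j by (intro emb_cong) (auto simp: reflect_def)
    ultimately show ?thesis using b emb_nonzero by simp
  qed
  ultimately show ?thesis unfolding admissible_def by auto
qed

lemma sign_bit:
  fixes f :: "(complex ^ 3) \<times> (complex ^ 3) \<Rightarrow> real" and b c :: bool
  assumes b: "\<And>v w. v \<noteq> 0 \<Longrightarrow> w \<noteq> 0 \<Longrightarrow> f (- v, w) = (if b then - f (v, w) else f (v, w))"
    and c: "\<And>v w. v \<noteq> 0 \<Longrightarrow> w \<noteq> 0 \<Longrightarrow> f (v, - w) = (if c then - f (v, w) else f (v, w))"
  obtains S :: "(complex ^ 3) \<times> (complex ^ 3) \<Rightarrow> bit" where
    "\<And>v w. v \<noteq> 0 \<Longrightarrow> w \<noteq> 0 \<Longrightarrow> S (- v, w) = S (v, w) + of_bool b"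
    "\<And>v w. v \<noteq> 0 \<Longrightarrow> w \<noteq> 0 \<Longrightarrow> S (v, - w) = S (v, w) + of_bool c"
    "\<And>p q. S p \<noteq> S q \<Longrightarrow> f p * f q \<le> 0"
proof -
  obtain L :: "complex ^ 3 \<Rightarrow> bool" where L: "\<And>v. v \<noteq> 0 \<Longrightarrow> L (- v) \<longleftrightarrow> \<not> L v"
    by (rule exists_odd_predicate) blast
  define T where "T p \<longleftrightarrow> (b \<and> L (fst p)) \<noteq> (c \<and> L (snd p))" for p
  define P where "P p \<longleftrightarrow> f p > 0 \<or> f p = 0 \<and> T p" for p
  have 1: "P (- v, w) \<longleftrightarrow> (P (v, w) \<noteq> b)" if "v \<noteq> 0" "w \<noteq> 0" for v w
    using b[OF that] L[OF that(1)] by (auto simp: P_def T_def split: if_splits)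
  have 2: "P (v, - w) \<longleftrightarrow> (P (v, w) \<noteq> c)" if "v \<noteq> 0" "w \<noteq> 0" for v w
    using c[OF that] L[OF that(2)] by (auto simp: P_def T_def split: if_splits)
  have 3: "f p * f q \<le> 0" if "P p \<noteq> P q" for p q
    using that unfolding P_def by (auto simp: mult_le_0_iff)
  show ?thesis
  proof (rule that[of "\<lambda>p. of_bool (P p)"])
    show "f p * f q \<le> 0" if "(of_bool (P p) :: bit) \<noteq> of_bool (P q)" for p q
      using that by (intro 3) auto
  qed (use 1 2 in \<open>auto simp: bit_add_self of_bool_def\<close>)
qed

lemma near_common_zero:
  fixes f :: "nat \<Rightarrow> (complex ^ 3) \<times> (complex ^ 3) \<Rightarrow> real" and b c :: "nat \<Rightarrow> bool"
  assumes "\<And>i v w. i < 10 \<Longrightarrow> v \<noteq> 0 \<Longrightarrow> w \<noteq> 0 \<Longrightarrow> f i (- v, w) = (if b i then - f i (v, w) else f i (v, w))"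
    and "\<And>i v w. i < 10 \<Longrightarrow> v \<noteq> 0 \<Longrightarrow> w \<noteq> 0 \<Longrightarrow> f i (v, - w) = (if c i then - f i (v, w) else f i (v, w))"
    and bc: "\<And>i. i < 5 \<Longrightarrow> b i \<and> \<not> c i" "\<And>i. 5 \<le> i \<Longrightarrow> i < 10 \<Longrightarrow> c i"
    and N: "even N" "0 < N"
  obtains u :: "nat \<Rightarrow> nat \<Rightarrow> real" where "\<And>i. u 0 i \<in> {-1..1}"
    "\<And>k i. k \<le> 10 \<Longrightarrow> \<bar>u k i - u 0 i\<bar> \<le> 1 / of_int N"
    "\<And>i. i < 10 \<Longrightarrow> f i (emb (\<lambda>j. u i (j + 5)), emb (u i)) *
       f i (emb (\<lambda>j. u (Suc i) (j + 5)), emb (u (Suc i))) \<le> 0"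
proof -
  have "\<exists>S. (\<forall>v w. v \<noteq> 0 \<longrightarrow> w \<noteq> 0 \<longrightarrow> S (- v, w) = S (v, w) + of_bool (b i) \<and>
      S (v, - w) = S (v, w) + of_bool (c i)) \<and> (\<forall>p q. (S p :: bit) \<noteq> S q \<longrightarrow> f i p * f i q \<le> 0)"
    if "i < 10" for i
  proof -
    obtain S :: "(complex ^ 3) \<times> (complex ^ 3) \<Rightarrow> bit" where
      "\<And>v w. v \<noteq> 0 \<Longrightarrow> w \<noteq> 0 \<Longrightarrow> S (- v, w) = S (v, w) + of_bool (b i)"
      "\<And>v w. v \<noteq> 0 \<Longrightarrow> w \<noteq> 0 \<Longrightarrow> S (v, - w) = S (v, w) + of_bool (c i)"
      "\<And>p q. S p \<noteq> S q \<Longrightarrow> f i p * f i q \<le> 0"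
      by (rule sign_bit[of "f i" "b i" "c i", OF assms(1,2)[OF \<open>i < 10\<close>]]) metis+
    then show ?thesis by (intro exI[of _ S]) blast
  qed
  then obtain S :: "nat \<Rightarrow> (complex ^ 3) \<times> (complex ^ 3) \<Rightarrow> bit" where S:
    "\<And>i v w. i < 10 \<Longrightarrow> v \<noteq> 0 \<Longrightarrow> w \<noteq> 0 \<Longrightarrow> S i (- v, w) = S i (v, w) + of_bool (b i)"
    "\<And>i v w. i < 10 \<Longrightarrow> v \<noteq> 0 \<Longrightarrow> w \<noteq> 0 \<Longrightarrow> S i (v, - w) = S i (v, w) + of_bool (c i)"
    "\<And>i p q. i < 10 \<Longrightarrow> S i p \<noteq> S i q \<Longrightarrow> f i p * f i q \<le> 0"
    by metis
  define s where "s i z = S i (emb (\<lambda>i. of_int (z (i + 5)) / of_int N), emb (\<lambda>i. of_int (z i) / of_int N))"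
    for i z
  have adm: "admissible N 5 10 (of_bool (b i)) (of_bool (c i)) (s i)" if "i < 10" for i
    unfolding s_def using S that N(2) by (intro admissible_emb) auto
  obtain vs where vs: "vs \<in> grid_paths N (5 + 5)"
    "\<And>i. i < 5 + 5 \<Longrightarrow> ((map s [0..<5] @ map s [5..<10]) ! i) (vs ! i) \<noteq>
      ((map s [0..<5] @ map s [5..<10]) ! i) (vs ! Suc i)"
  proof (rule exists_alternating_path[OF N, of "map s [0..<5]" 5 "map s [5..<10]" 5])
    show "admissible N 5 (5 + 5) 1 0 t" if t: "t \<in> set (map s [0..<5])" for t
    proof -
      have "t \<in> s ` {0..<5}" using t by (simp only: set_map set_upt)
      then obtain i where "i < 5" "t = s i" by auto
      then show ?thesis using adm[of i] bc(1)[of i] by simp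
    qed
    show "\<exists>a. admissible N 5 (5 + 5) a 1 t" if t: "t \<in> set (map s [5..<10])" for t
    proof -
      have "t \<in> s ` {5..<10}" using t by (simp only: set_map set_upt)
      then obtain i where "5 \<le> i" "i < 10" "t = s i" by auto
      then show ?thesis using adm[of i] bc(2)[of i] by (intro exI[of _ "of_bool (b i)"]) simp
    qed
  qed auto
  have map_s: "(map s [0..<5] @ map s [5..<10]) ! i = s i" if "i < 10" for i
  proof -
    have "map s [0..<5] @ map s [5..<10] = map s [0..<10]"
      unfolding map_append[symmetric] using upt_add_eq_append[of 0 5 5] by simp
    then show ?thesis using that by simp
  qed
  define u :: "nat \<Rightarrow> nat \<Rightarrow> real" where "u k i = of_int ((vs ! k) i) / of_int N" for k i
  show ?thesis
  proof (rule that[of u])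
    fix i
    have "\<bar>(vs ! 0) i\<bar> \<le> N" using path_in_grid[OF vs(1), of 0] N(2) unfolding in_grid_def
      by (cases "i < 10") auto
    then have "\<bar>real_of_int ((vs ! 0) i)\<bar> \<le> real_of_int N" by linarith
    then show "u 0 i \<in> {-1..1}" using N(2) by (simp add: u_def field_simps abs_le_iff)
  next
    fix k i :: nat assume "k \<le> 10"
    then have "\<bar>(vs ! k) i - (vs ! 0) i\<bar> \<le> 1" using path_dist[OF vs(1)] by simp
    then have "\<bar>real_of_int ((vs ! k) i) - real_of_int ((vs ! 0) i)\<bar> \<le> 1" by linarith
    moreover have "u k i - u 0 i = (real_of_int ((vs ! k) i) - real_of_int ((vs ! 0) i)) / real_of_int N"
      by (simp add: u_def diff_divide_distrib)
    ultimately show "\<bar>u k i - u 0 i\<bar> \<le> 1 / of_int N" using N(2)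
      by (simp add: abs_divide divide_right_mono)
  next
    fix i :: nat assume i: "i < 10"
    then have "s i (vs ! i) \<noteq> s i (vs ! Suc i)" using vs(2)[of i] map_s by simp
    then show "f i (emb (\<lambda>j. u i (j + 5)), emb (u i)) *
       f i (emb (\<lambda>j. u (Suc i) (j + 5)), emb (u (Suc i))) \<le> 0"
      using S(3)[OF i] unfolding s_def u_def by blast
  qed
qed

theorem product_borsuk_ulam:
  fixes f :: "nat \<Rightarrow> (complex ^ 3) \<times> (complex ^ 3) \<Rightarrow> real" and b c :: "nat \<Rightarrow> bool"
  assumes cont: "\<And>i. i < 10 \<Longrightarrow> continuous_on {(v, w). v \<noteq> 0 \<and> w \<noteq> 0} (f i)"
    and b: "\<And>i v w. i < 10 \<Longrightarrow> v \<noteq> 0 \<Longrightarrow> w \<noteq> 0 \<Longrightarrow> f i (- v, w) = (if b i then - f i (v, w) else f i (v, w))"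
    and c: "\<And>i v w. i < 10 \<Longrightarrow> v \<noteq> 0 \<Longrightarrow> w \<noteq> 0 \<Longrightarrow> f i (v, - w) = (if c i then - f i (v, w) else f i (v, w))"
    and bc: "\<And>i. i < 5 \<Longrightarrow> b i \<and> \<not> c i" "\<And>i. 5 \<le> i \<Longrightarrow> i < 10 \<Longrightarrow> c i"
  obtains v w where "v \<noteq> 0" "w \<noteq> 0" "\<And>i. i < 10 \<Longrightarrow> f i (v, w) = 0"
proof -
  define N :: "nat \<Rightarrow> int" where "N n = 2 * (int n + 1)" for n
  have "\<exists>u :: nat \<Rightarrow> nat \<Rightarrow> real. (\<forall>i. u 0 i \<in> {-1..1}) \<and>
    (\<forall>k i. k \<le> 10 \<longrightarrow> \<bar>u k i - u 0 i\<bar> \<le> 1 / of_int (N n)) \<and>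
    (\<forall>i<10. f i (emb (\<lambda>j. u i (j + 5)), emb (u i)) *
       f i (emb (\<lambda>j. u (Suc i) (j + 5)), emb (u (Suc i))) \<le> 0)" for n
    by (rule near_common_zero[of f b c "N n"]) (use b c bc in \<open>auto simp: N_def\<close>)
  then obtain u :: "nat \<Rightarrow> nat \<Rightarrow> nat \<Rightarrow> real" where u: "\<And>n i. u n 0 i \<in> {-1..1}"
    "\<And>n k i. k \<le> 10 \<Longrightarrow> \<bar>u n k i - u n 0 i\<bar> \<le> 1 / of_int (N n)"
    "\<And>n i. i < 10 \<Longrightarrow> f i (emb (\<lambda>j. u n i (j + 5)), emb (u n i)) *
       f i (emb (\<lambda>j. u n (Suc i) (j + 5)), emb (u n (Suc i))) \<le> 0"
    by metis
  have "compact (PiE UNIV (\<lambda>_::nat. {-1..1::real}))"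
    using compactin_PiE[of "\<lambda>_. euclidean" UNIV "\<lambda>_::nat. {-1..1::real}"]
    by (simp add: euclidean_product_topology)
  then have "seq_compact (PiE UNIV (\<lambda>_::nat. {-1..1::real}))"
    by (simp add: compact_eq_seq_compact_metric)
  then obtain t r where t: "t \<in> PiE UNIV (\<lambda>_::nat. {-1..1::real})" and r: "strict_mono r"
    and lim: "((\<lambda>n. u n 0) \<circ> r) \<longlonglongrightarrow> t"
    using u(1) unfolding seq_compact_def by (metis (no_types, lifting) PiE_UNIV_domain Pi_I)
  have 0: "(\<lambda>n. u (r n) 0 i) \<longlonglongrightarrow> t i" for i
    using continuous_on_tendsto_compose[OF continuous_on_product_coordinates[of i] lim] by (simp add: comp_def)
  have uk: "(\<lambda>n. u (r n) k i) \<longlonglongrightarrow> t i" if k: "k \<le> 10" for k i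
  proof -
    have "(\<lambda>n. 1 / of_int (N n) :: real) \<longlonglongrightarrow> 0"
    proof (rule real_tendsto_sandwich[of "\<lambda>_. 0" _ _ "\<lambda>n. 1 / real (Suc n)"])
      show "\<forall>\<^sub>F n in sequentially. 1 / real_of_int (N n) \<le> 1 / real (Suc n)"
        by (intro always_eventually allI divide_left_mono) (auto simp: N_def)
    qed (use lim_1_over_n LIMSEQ_Suc[OF lim_1_over_n[where 'a=real]] in \<open>auto simp: N_def intro!: always_eventually\<close>)
    then have "(\<lambda>n. 1 / of_int (N (r n)) :: real) \<longlonglongrightarrow> 0"
      using LIMSEQ_subseq_LIMSEQ[OF _ r] by (force simp: comp_def)
    then have "(\<lambda>n. u (r n) k i - u (r n) 0 i) \<longlonglongrightarrow> 0"
      by (rule Lim_null_comparison[rotated]) (use u(2)[OF k] in \<open>auto intro!: always_eventually\<close>)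
    from tendsto_add[OF this 0[of i]] show ?thesis by simp
  qed
  define p where "p = (emb (\<lambda>j. t (j + 5)), emb t)"
  let ?q = "\<lambda>k n. (emb (\<lambda>j. u (r n) k (j + 5)), emb (u (r n) k))"
  have q: "?q k \<longlonglongrightarrow> p" if "k \<le> 10" for k
    unfolding p_def using uk[OF that] by (intro tendsto_Pair tendsto_emb) auto
  show ?thesis
  proof (rule that[of "fst p" "snd p"])
    show "fst p \<noteq> 0" "snd p \<noteq> 0" by (simp_all add: p_def emb_nonzero)
    fix i :: nat assume i: "i < 10"
    have "(\<lambda>n. f i (?q k n)) \<longlonglongrightarrow> f i p" if "k \<le> 10" for k
      by (rule continuous_on_tendsto_compose[OF cont[OF i] q[OF that]])
        (auto simp: p_def emb_nonzero)
    from tendsto_mult[OF this this, of i "Suc i"] i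
    have "(\<lambda>n. f i (?q i n) * f i (?q (Suc i) n)) \<longlonglongrightarrow> f i p * f i p" by simp
    then have "f i p * f i p \<le> 0"
      by (rule LIMSEQ_le_const2) (use u(3)[OF i] in auto)
    then show "f i (fst p, snd p) = 0"
      by (metis antisym mult_eq_0_iff prod.collapse zero_le_square)
  qed
qed

section \<open>Fermat quartics\<close>

lemma abs_cproj_eq_iff:
  "v \<noteq> 0 \<Longrightarrow> w \<noteq> 0 \<Longrightarrow> abs_cproj v = abs_cproj w \<longleftrightarrow> (\<exists>c. c \<noteq> 0 \<and> w = c *s v)"
  using Quotient3_rel[OF Quotient3_cproj, of v w]
  by (auto intro: exI[of _ "1::complex"])

lemma cproj_cases:
  obtains v where "v \<noteq> 0" "x = abs_cproj v"
  using Quotient3_rep_reflp[OF Quotient3_cproj, of x] Quotient3_abs_rep[OF Quotient3_cproj, of x]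
  by metis

lemma continuous_on_abs_cproj: "continuous_on {v. v \<noteq> 0} abs_cproj"
proof -
  have "open {v :: complex ^ 'a. v \<noteq> 0}"
    by (simp add: open_Collect_neq)
  moreover have "abs_cproj -` B \<inter> {v. v \<noteq> 0} = {v. v \<noteq> 0 \<and> abs_cproj v \<in> B}" for B :: "'a cproj set"
    by auto
  ultimately show ?thesis by (simp add: continuous_on_open_vimage open_cproj_def)
qed

instance cproj :: (finite) t2_space
proof
  fix x y :: "'a cproj"
  assume "x \<noteq> y"
  obtain a where a: "a \<noteq> 0" "x = abs_cproj a" by (rule cproj_cases)
  obtain b where b: "b \<noteq> 0" "y = abs_cproj b" by (rule cproj_cases)
  define h where "h z = (\<Sum>i\<in>UNIV. \<Sum>j\<in>UNIV. cmod (z $ i * a $ j - z $ j * a $ i))" for z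
  define n where "n z = (\<Sum>i\<in>UNIV. cmod (z $ i))" for z :: "complex ^ 'a"
  have h_scale: "h (c *s z) = cmod c * h z" for c z
  proof -
    have "cmod ((c *s z) $ i * a $ j - (c *s z) $ j * a $ i) = cmod c * cmod (z $ i * a $ j - z $ j * a $ i)" for i j
      by (simp flip: norm_mult add: algebra_simps)
    then show ?thesis by (simp add: h_def sum_distrib_left)
  qed
  have n_scale: "n (c *s z) = cmod c * n z" for c z
    by (simp add: n_def sum_distrib_left norm_mult)
  have n_pos: "n z > 0" if "z \<noteq> 0" for z
  proof -
    have "n z \<noteq> 0" using that by (auto simp: n_def sum_nonneg_eq_0_iff vec_eq_iff)
    moreover have "n z \<ge> 0" by (simp add: n_def sum_nonneg)
    ultimately show ?thesis by simp
  qed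
  have "h b > 0"
  proof (rule ccontr)
    assume "\<not> h b > 0"
    moreover have "h b \<ge> 0" by (simp add: h_def sum_nonneg)
    ultimately have "h b = 0" by simp
    then have *: "b $ i * a $ j = b $ j * a $ i" for i j
      by (simp add: h_def sum_nonneg_eq_0_iff sum_nonneg)
    obtain k where k: "a $ k \<noteq> 0" using a by (auto simp: vec_eq_iff)
    have "b = (b $ k / a $ k) *s a"
      using *[of _ k] k by (simp add: vec_eq_iff field_simps)
    then have "\<exists>c. c \<noteq> 0 \<and> b = c *s a" using b(1) by (metis vector_smult_lzero)
    then show False using \<open>x \<noteq> y\<close> a b by (simp add: abs_cproj_eq_iff)
  qed
  define e where "e = h b / n b / 2"
  have e: "0 < e" "e * n b < h b"
    using \<open>h b > 0\<close> n_pos[OF b(1)] by (simp_all add: e_def field_simps)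
  define U where "U = {abs_cproj z | z. z \<noteq> 0 \<and> h z < e * n z}"
  define V where "V = {abs_cproj z | z. z \<noteq> 0 \<and> e * n z < h z}"
  have U: "abs_cproj z \<in> U \<longleftrightarrow> h z < e * n z" if z: "z \<noteq> 0" for z
  proof
    assume "abs_cproj z \<in> U"
    then obtain z' where z': "z' \<noteq> 0" "h z' < e * n z'" "abs_cproj z = abs_cproj z'"
      by (auto simp: U_def)
    then obtain c where c: "c \<noteq> 0" "z' = c *s z"
      using abs_cproj_eq_iff[OF z z'(1)] by blast
    from z'(2) show "h z < e * n z" using c
      by (simp add: h_scale n_scale mult.left_commute[of e])
  qed (use z in \<open>auto simp: U_def\<close>)
  have V: "abs_cproj z \<in> V \<longleftrightarrow> e * n z < h z" if z: "z \<noteq> 0" for z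
  proof
    assume "abs_cproj z \<in> V"
    then obtain z' where z': "z' \<noteq> 0" "e * n z' < h z'" "abs_cproj z = abs_cproj z'"
      by (auto simp: V_def)
    then obtain c where c: "c \<noteq> 0" "z' = c *s z"
      using abs_cproj_eq_iff[OF z z'(1)] by blast
    from z'(2) show "e * n z < h z" using c
      by (simp add: h_scale n_scale mult.left_commute[of e])
  qed (use z in \<open>auto simp: V_def\<close>)
  have cont: "continuous_on UNIV h" "continuous_on UNIV n"
    unfolding h_def n_def by (intro continuous_intros)+
  show "\<exists>U V. open U \<and> open V \<and> x \<in> U \<and> y \<in> V \<and> U \<inter> V = {}"
  proof (intro exI conjI)
    have "{v. v \<noteq> 0 \<and> abs_cproj v \<in> U} = {v. v \<noteq> 0} \<inter> {v. h v < e * n v}" using U by auto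
    then show "open U" unfolding open_cproj_def
      by (auto intro!: open_Int open_Collect_neq open_Collect_less continuous_intros cont)
    have "{v. v \<noteq> 0 \<and> abs_cproj v \<in> V} = {v. v \<noteq> 0} \<inter> {v. e * n v < h v}" using V by auto
    then show "open V" unfolding open_cproj_def
      by (auto intro!: open_Int open_Collect_neq open_Collect_less continuous_intros cont)
    have "h a = 0" by (simp add: h_def mult.commute)
    then show "x \<in> U" using a U e(1) n_pos by simp
    show "y \<in> V" using b V e(2) by simp
    show "U \<inter> V = {}"
    proof (rule ccontr)
      assume "U \<inter> V \<noteq> {}"
      then obtain q where "q \<in> U" "q \<in> V" by blast
      then show False by (cases q rule: cproj_cases) (use U V in force)
    qed
  qed
qed

definition lin :: "complex ^ 3 \<Rightarrow> complex ^ 3 \<Rightarrow> complex"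
  where "lin a x = (\<Sum>i\<in>UNIV. a $ i * x $ i)"

lemma lin_simps [simp]:
  "lin (a + b) x = lin a x + lin b x" "lin (- a) x = - lin a x" "lin (c *s a) x = c * lin a x"
  "lin (a - b) x = lin a x - lin b x"
  "lin a (x + y) = lin a x + lin a y" "lin a (c *s x) = c * lin a x" "lin a (x - y) = lin a x - lin a y"
  by (simp_all add: lin_def sum_3 algebra_simps)

lemma sum_quartic_exp:
  "(\<Sum>e\<in>UNIV. g (expo e)) =
    (\<Sum>a\<le>4. \<Sum>b\<le>4 - a. g (\<lambda>i. if i = 1 then a else if i = 2 then b else 4 - a - b))"
proof -
  let ?f = "\<lambda>(a::nat,b::nat) (i::3). if i = 1 then a else if i = 2 then b else 4 - a - b"
  have inj: "inj_on ?f A" for A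
  proof (rule inj_on_subset[OF _ subset_UNIV], rule injI)
    fix p q assume "?f p = ?f q"
    then have "?f p 1 = ?f q 1" "?f p 2 = ?f q 2" by simp_all
    then show "p = q" by (cases p; cases q) simp
  qed
  have "(\<Sum>e\<in>UNIV. g (expo e)) = sum g (range expo)"
    by (subst sum.reindex) (simp_all add: inj_on_def expo_inject)
  also have "range expo = {e. (\<Sum>i\<in>UNIV. e i) = 4}"
    by (rule type_definition.Rep_range[OF type_definition_quartic_exp])
  also have "\<dots> = ?f ` (SIGMA a:{..4}. {..4 - a})" by (rule quartic_exp_set_eq)
  also have "sum g \<dots> = (\<Sum>p\<in>(SIGMA a:{..4}. {..4 - a}). g (?f p))"
    by (subst sum.reindex[OF inj]) (simp add: comp_def)
  also have "\<dots> = (\<Sum>(a, b)\<in>(SIGMA a:{..4}. {..4 - a}). g (?f (a, b)))"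
    by (rule sum.cong) auto
  also have "\<dots> = (\<Sum>a\<le>4. \<Sum>b\<le>4 - a. g (?f (a, b)))"
    by (rule sum.Sigma[symmetric]) auto
  finally show ?thesis by simp
qed

definition pow4 :: "complex ^ 3 \<Rightarrow> complex ^ quartic_exp"
  where "pow4 a = (\<chi> e. of_nat ((4 choose expo e 1) * ((4 - expo e 1) choose expo e 2)) *
    (\<Prod>i\<in>UNIV. a $ i ^ expo e i))"

lemma quartic_eval_pow4: "quartic_eval (pow4 a) x = lin a x ^ 4"
proof -
  define X where "X i = a $ i * x $ i" for i
  define g where "g e = of_nat ((4 choose e 1) * ((4 - e 1) choose e 2)) * (\<Prod>i\<in>UNIV. X i ^ e i)" for e
  have "quartic_eval (pow4 a) x = (\<Sum>e\<in>UNIV. g (expo e))"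
    by (simp add: quartic_eval_def pow4_def g_def X_def power_mult_distrib prod.distrib mult.assoc)
  also have "\<dots> = (\<Sum>k\<le>4. \<Sum>l\<le>4 - k. g (\<lambda>i. if i = 1 then k else if i = 2 then l else 4 - k - l))"
    by (rule sum_quartic_exp[of g])
  also have "\<dots> = (\<Sum>k\<le>4. \<Sum>l\<le>4 - k. of_nat (4 choose k) * X 1 ^ k * (of_nat (4 - k choose l) * X 2 ^ l * X 3 ^ (4 - k - l)))"
  proof (intro sum.cong HOL.refl)
    fix k l :: nat
    have prod3: "(\<Prod>i\<in>UNIV. f i) = f 1 * f 2 * f 3" for f :: "3 \<Rightarrow> complex"
      unfolding UNIV_3 by (simp add: ac_simps)
    show "g (\<lambda>i. if i = 1 then k else if i = 2 then l else 4 - k - l) =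
        of_nat (4 choose k) * X 1 ^ k * (of_nat (4 - k choose l) * X 2 ^ l * X 3 ^ (4 - k - l))"
      unfolding g_def prod3 by simp
  qed
  also have "\<dots> = (\<Sum>k\<le>4. of_nat (4 choose k) * X 1 ^ k * (X 2 + X 3) ^ (4 - k))"
    by (simp only: binomial_ring sum_distrib_left)
  also have "\<dots> = (X 1 + (X 2 + X 3)) ^ 4" by (simp only: binomial_ring)
  also have "X 1 + (X 2 + X 3) = lin a x" by (simp add: lin_def sum_3 X_def)
  finally show ?thesis .
qed

lemma pow4_minus: "pow4 (- a) = pow4 a"
proof -
  have "(\<Prod>i\<in>UNIV. (- a) $ i ^ expo e i) = (\<Prod>i\<in>UNIV. a $ i ^ expo e i)" for e
  proof -
    have "(\<Prod>i\<in>UNIV. (- a) $ i ^ expo e i) = (\<Prod>i\<in>UNIV. (- 1) ^ expo e i * a $ i ^ expo e i)"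
      by (simp flip: power_mult_distrib)
    also have "\<dots> = (- 1) ^ (\<Sum>i\<in>UNIV. expo e i) * (\<Prod>i\<in>UNIV. a $ i ^ expo e i)"
      by (simp add: prod.distrib power_sum)
    finally show ?thesis using expo[of e] by simp
  qed
  then show ?thesis by (simp add: pow4_def)
qed

lemma continuous_on_pow4 [continuous_intros]:
  "continuous_on S f \<Longrightarrow> continuous_on S (\<lambda>x. pow4 (f x))"
  unfolding pow4_def by (intro continuous_intros)

definition fermat :: "complex ^ 3 \<Rightarrow> complex ^ 3 \<Rightarrow> complex ^ 3 \<Rightarrow> complex ^ quartic_exp"
  where "fermat a b c = pow4 a + pow4 b + pow4 c"

lemma quartic_eval_fermat: "quartic_eval (fermat a b c) x = lin a x ^ 4 + lin b x ^ 4 + lin c x ^ 4"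
proof -
  have "quartic_eval (F + G) x = quartic_eval F x + quartic_eval G x" for F G
    by (simp add: quartic_eval_def distrib_right sum.distrib)
  then show ?thesis by (simp add: fermat_def quartic_eval_pow4)
qed

lemma quartic_partial_fermat:
  "quartic_partial i (fermat a b c) x =
    4 * (lin a x ^ 3 * a $ i + lin b x ^ 3 * b $ i + lin c x ^ 3 * c $ i)"
proof -
  have lin_axis: "lin a (axis i t) = a $ i * t" for a t
    by (simp add: lin_def axis_def if_distrib cong: if_cong)
  have "((\<lambda>t. quartic_eval (fermat a b c) (x + axis i t)) has_field_derivative
    4 * (lin a x ^ 3 * a $ i + lin b x ^ 3 * b $ i + lin c x ^ 3 * c $ i)) (at 0)"
    unfolding quartic_eval_fermat lin_simps lin_axis
    by (rule derivative_eq_intros refl)+ (simp add: algebra_simps)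
  then show ?thesis unfolding quartic_partial_def by (rule DERIV_imp_deriv)
qed

definition det3 :: "complex ^ 3 \<Rightarrow> complex ^ 3 \<Rightarrow> complex ^ 3 \<Rightarrow> complex"
  where "det3 a b c = a $ 1 * (b $ 2 * c $ 3 - b $ 3 * c $ 2) - a $ 2 * (b $ 1 * c $ 3 - b $ 3 * c $ 1) +
    a $ 3 * (b $ 1 * c $ 2 - b $ 2 * c $ 1)"

lemma det3_kernel:
  assumes "det3 a b c \<noteq> 0" "lin a x = 0" "lin b x = 0" "lin c x = 0"
  shows "x = 0"
proof -
  have "det3 a b c * x $ 1 = lin a x * (b $ 2 * c $ 3 - b $ 3 * c $ 2) - lin b x * (a $ 2 * c $ 3 - a $ 3 * c $ 2)
      + lin c x * (a $ 2 * b $ 3 - a $ 3 * b $ 2)"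
    by (simp add: det3_def lin_def sum_3 algebra_simps)
  moreover have "det3 a b c * x $ 2 = - lin a x * (b $ 1 * c $ 3 - b $ 3 * c $ 1) + lin b x * (a $ 1 * c $ 3 - a $ 3 * c $ 1)
      - lin c x * (a $ 1 * b $ 3 - a $ 3 * b $ 1)"
    by (simp add: det3_def lin_def sum_3 algebra_simps)
  moreover have "det3 a b c * x $ 3 = lin a x * (b $ 1 * c $ 2 - b $ 2 * c $ 1) - lin b x * (a $ 1 * c $ 2 - a $ 2 * c $ 1)
      + lin c x * (a $ 1 * b $ 2 - a $ 2 * b $ 1)"
    by (simp add: det3_def lin_def sum_3 algebra_simps)
  ultimately show ?thesis using assms by (simp add: vec_eq_iff forall_3)
qed

lemma det3_rows:
  assumes "det3 a b c \<noteq> 0" and "\<And>i. \<alpha> * a $ i + \<beta> * b $ i + \<gamma> * c $ i = 0"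
  shows "\<alpha> = 0" "\<beta> = 0" "\<gamma> = 0"
proof -
  define s where "s i = \<alpha> * a $ i + \<beta> * b $ i + \<gamma> * c $ i" for i
  have s: "s i = 0" for i using assms(2) by (simp add: s_def)
  have "det3 a b c * \<alpha> = s 1 * (b $ 2 * c $ 3 - b $ 3 * c $ 2) - s 2 * (b $ 1 * c $ 3 - b $ 3 * c $ 1)
      + s 3 * (b $ 1 * c $ 2 - b $ 2 * c $ 1)"
    by (simp add: det3_def s_def algebra_simps)
  moreover have "det3 a b c * \<beta> = - s 1 * (a $ 2 * c $ 3 - a $ 3 * c $ 2) + s 2 * (a $ 1 * c $ 3 - a $ 3 * c $ 1)
      - s 3 * (a $ 1 * c $ 2 - a $ 2 * c $ 1)"
    by (simp add: det3_def s_def algebra_simps)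
  moreover have "det3 a b c * \<gamma> = s 1 * (a $ 2 * b $ 3 - a $ 3 * b $ 2) - s 2 * (a $ 1 * b $ 3 - a $ 3 * b $ 1)
      + s 3 * (a $ 1 * b $ 2 - a $ 2 * b $ 1)"
    by (simp add: det3_def s_def algebra_simps)
  ultimately show "\<alpha> = 0" "\<beta> = 0" "\<gamma> = 0" using s assms(1) by simp_all
qed

lemma det3_solve:
  assumes "det3 a b c \<noteq> 0"
  obtains x where "lin a x = \<alpha>" "lin b x = \<beta>" "lin c x = \<gamma>"
proof -
  define y :: "complex ^ 3" where "y = vector [
    \<alpha> * (b $ 2 * c $ 3 - b $ 3 * c $ 2) - \<beta> * (a $ 2 * c $ 3 - a $ 3 * c $ 2) + \<gamma> * (a $ 2 * b $ 3 - a $ 3 * b $ 2),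
    - \<alpha> * (b $ 1 * c $ 3 - b $ 3 * c $ 1) + \<beta> * (a $ 1 * c $ 3 - a $ 3 * c $ 1) - \<gamma> * (a $ 1 * b $ 3 - a $ 3 * b $ 1),
    \<alpha> * (b $ 1 * c $ 2 - b $ 2 * c $ 1) - \<beta> * (a $ 1 * c $ 2 - a $ 2 * c $ 1) + \<gamma> * (a $ 1 * b $ 2 - a $ 2 * b $ 1)]"
  have "lin a y = det3 a b c * \<alpha>" "lin b y = det3 a b c * \<beta>" "lin c y = det3 a b c * \<gamma>"
    by (simp_all add: det3_def lin_def sum_3 y_def vector_3 algebra_simps)
  then show ?thesis using assms by (intro that[of "inverse (det3 a b c) *s y"]) simp_all
qed

lemma nonsingular_fermat:
  assumes "det3 a b c \<noteq> 0"
  shows "nonsingular_form (fermat a b c)"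
  unfolding nonsingular_form_def
proof (intro notI, elim exE conjE)
  fix x assume x: "x \<noteq> 0" and "\<forall>i. quartic_partial i (fermat a b c) x = 0"
  then have "lin a x ^ 3 * a $ i + lin b x ^ 3 * b $ i + lin c x ^ 3 * c $ i = 0" for i
    unfolding quartic_partial_fermat by (metis mult_eq_0_iff zero_neq_numeral)
  from det3_rows[OF assms this] have "lin a x = 0" "lin b x = 0" "lin c x = 0" by simp_all
  then show False using det3_kernel[OF assms] x by blast
qed

lemma nonsingular_form_nonzero: "nonsingular_form F \<Longrightarrow> F \<noteq> 0"
proof
  assume "nonsingular_form F" "F = 0"
  moreover have "quartic_eval 0 x = 0" for x by (simp add: quartic_eval_def)
  moreover have "axis (1::3) (1::complex) \<noteq> 0" by (simp add: axis_eq_0_iff)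
  ultimately show False by (auto simp: nonsingular_form_def quartic_partial_def)
qed

lemma order_linear: "[:x, y:] \<noteq> 0 \<Longrightarrow> order 0 [:x, y :: complex:] = (if x = 0 then 1 else 0)"
proof (cases "x = 0")
  case True
  assume "[:x, y:] \<noteq> 0"
  then have y: "[:x, y:] = smult y ([:- 0, 1:] ^ 1)" "y \<noteq> 0" using True by auto
  show ?thesis unfolding y(1) order_smult[OF y(2)] order_power_n_n using True by simp
qed (simp add: order_0I)

lemma bitangent_fermat:
  assumes D: "det3 a b c \<noteq> 0"
  shows "bitangent (abs_cproj (fermat a b c)) (abs_cproj (a + b + c))"
proof -
  define m where "m = a + b + c"
  define F where "F = fermat a b c"
  define \<omega> where "\<omega> = Complex (- 1/2) (sqrt 3 / 2)"
  define \<omega>' where "\<omega>' = - 1 - \<omega>"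
  have "\<omega> * \<omega> = \<omega>'" by (simp add: \<omega>_def \<omega>'_def complex_eq_iff)
  then have \<omega>\<omega>': "\<omega> * \<omega>' = 1" unfolding \<omega>'_def right_diff_distrib by (simp add: \<omega>'_def)
  have F0: "F \<noteq> 0" using nonsingular_form_nonzero[OF nonsingular_fermat[OF D]] by (simp add: F_def)
  have m0: "m \<noteq> 0"
  proof
    assume "m = 0"
    then have "1 * a $ i + 1 * b $ i + 1 * c $ i = 0" for i by (simp add: m_def vec_eq_iff)
    from det3_rows(1)[OF D this] show False by simp
  qed
  have inc: "incident_form m x \<longleftrightarrow> lin m x = 0" for x by (simp add: incident_form_def lin_def)
  obtain P where P: "lin a P = \<omega>" "lin b P = 1" "lin c P = - 1 - \<omega>" by (rule det3_solve[OF D])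
  obtain Q where Q: "lin a Q = \<omega>'" "lin b Q = 1" "lin c Q = - 1 - \<omega>'" by (rule det3_solve[OF D])
  have PQ0: "P \<noteq> 0" "Q \<noteq> 0" using P(2) Q(2) by (auto simp: lin_def)
  have ker: "x = lin b x *s R" if "lin m x = 0" "lin a x = z * lin b x"
      and R: "lin a R = z" "lin b R = 1" "lin c R = - 1 - z" for x R z
  proof -
    have "lin c x = (- 1 - z) * lin b x"
      using that(1,2) by (simp add: m_def algebra_simps) (metis add.commute add_eq_0_iff minus_add_distrib)
    then have "x - lin b x *s R = 0" using that(2) R by (intro det3_kernel[OF D]) simp_all
    then show ?thesis by simp
  qed
  have eqR: "abs_cproj x = abs_cproj R \<longleftrightarrow> lin m x = 0 \<and> lin a x = z * lin b x" if x: "x \<noteq> 0"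
      and R: "R \<noteq> 0" "lin a R = z" "lin b R = 1" "lin c R = - 1 - z" for x R z
  proof
    assume "abs_cproj x = abs_cproj R"
    then obtain d where d: "d \<noteq> 0" "R = d *s x" using x R(1) by (auto simp: abs_cproj_eq_iff)
    have "lin m R = 0" using R by (simp add: m_def)
    moreover have "d * lin a x = d * (z * lin b x)"
      using R(2,3) unfolding d(2) lin_simps by (metis mult.left_commute mult.right_neutral)
    ultimately show "lin m x = 0 \<and> lin a x = z * lin b x" using d by simp
  next
    assume "lin m x = 0 \<and> lin a x = z * lin b x"
    then have *: "x = lin b x *s R" using ker R by blast
    then have "lin b x \<noteq> 0" using x by (metis vector_smult_lzero)
    then show "abs_cproj x = abs_cproj R" using * x R(1) abs_cproj_eq_iff by metis
  qed
  have nz: "[:lin a p - z * lin b p, lin a q - z * lin b q:] \<noteq> 0"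
    if p: "p \<noteq> 0" "lin m p = 0" and q: "second_point m p q"
      and R: "lin a R = z" "lin b R = 1" "lin c R = - 1 - z" for p q R z
  proof
    assume "[:lin a p - z * lin b p, lin a q - z * lin b q:] = 0"
    then have e: "lin a p = z * lin b p" "lin a q = z * lin b q" by simp_all
    have q': "lin m q = 0" "\<nexists>d. q = d *s p" using q by (simp_all add: second_point_def inc)
    have p': "p = lin b p *s R" using ker[OF p(2) e(1) R] .
    then have "lin b p \<noteq> 0" using p(1) by (metis vector_smult_lzero)
    moreover have "q = lin b q *s R" using ker[OF q'(1) e(2) R] .
    ultimately have "q = (lin b q / lin b p) *s p"
      using p' by (metis nonzero_eq_divide_eq vector_smult_assoc)
    then show False using q'(2) by blast
  qed
  have mult: "intersection_mult_form F m p = (if abs_cproj p = abs_cproj P then 2 else 0) +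
      (if abs_cproj p = abs_cproj Q then 2 else 0)" if p: "p \<noteq> 0" for p
  proof (cases "lin m p = 0")
    case False
    then show ?thesis
      using eqR[OF p PQ0(1) P] eqR[OF p PQ0(2) Q(1,2,3)] by (simp add: intersection_mult_form_def inc)
  next
    case True
    obtain q where q: "second_point m p q" using second_point_exists[OF p] by blast
    then have mq: "lin m q = 0" by (simp add: second_point_def inc)
    define L where "L z = [:lin a p - z * lin b p, lin a q - z * lin b q:]" for z
    have "poly (restrict_poly F p q) t = poly (smult 2 ((L \<omega> * L \<omega>')\<^sup>2)) t" for t
    proof -
      define A B where "A = lin a (p + t *s q)" and "B = lin b (p + t *s q)"
      have "lin m (p + t *s q) = 0" using True mq by simp
      then have C: "lin c (p + t *s q) = - A - B"
        by (simp add: m_def A_def B_def algebra_simps) (metis add.assoc add.commute add_eq_0_iff minus_add_distrib)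
      have "poly (restrict_poly F p q) t = A ^ 4 + B ^ 4 + (- A - B) ^ 4"
        unfolding poly_restrict_poly F_def quartic_eval_fermat C by (simp add: A_def B_def)
      also have "\<dots> = 2 * (A * A + A * B + 1 * B * B)\<^sup>2"
        by (simp add: power2_eq_square power4_eq_xxxx algebra_simps)
      also have "\<dots> = 2 * ((A - \<omega> * B) * (A - \<omega>' * B))\<^sup>2"
        unfolding \<omega>\<omega>'[symmetric] by (simp add: \<omega>'_def algebra_simps)
      finally show ?thesis by (simp add: L_def A_def B_def algebra_simps)
    qed
    then have r: "restrict_poly F p q = smult 2 ((L \<omega> * L \<omega>')\<^sup>2)"
      by (intro poly_eq_poly_eq_iff[THEN iffD1]) (simp add: fun_eq_iff)
    have L0: "L \<omega> \<noteq> 0" "L \<omega>' \<noteq> 0"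
      unfolding L_def using nz[OF p True q P] nz[OF p True q Q] by blast+
    have ordL: "order 0 (L \<omega>) = (if abs_cproj p = abs_cproj P then 1 else 0)"
        "order 0 (L \<omega>') = (if abs_cproj p = abs_cproj Q then 1 else 0)"
      using L0 unfolding L_def
      by (simp_all add: order_linear eqR[OF p PQ0(1) P] eqR[OF p PQ0(2) Q] True)
    have "intersection_mult_form F m p = order 0 (restrict_poly F p q)"
      using m0 p True q by (intro intersection_mult_form_eq) (simp_all add: inc)
    also have "\<dots> = 2 * (order 0 (L \<omega>) + order 0 (L \<omega>'))"
      unfolding r using L0 by (simp add: order_smult power2_eq_square order_mult)
    finally show ?thesis using ordL by simp
  qed
  have "intersection_mult (abs_cproj F) (abs_cproj m) R =
      (if R = abs_cproj P then 2 else 0) + (if R = abs_cproj Q then 2 else 0)" for R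
  proof -
    obtain p where p: "p \<noteq> 0" "R = abs_cproj p" by (rule cproj_cases)
    have "intersection_mult (abs_cproj F) (abs_cproj m) (abs_cproj p) = intersection_mult_form F m p"
      by (rule intersection_mult.abs_eq) (use F0 m0 p(1) in \<open>auto simp: eq_onp_def intro: exI[of _ "1::complex"]\<close>)
    then show ?thesis using mult[OF p(1)] p(2) by simp
  qed
  then show ?thesis unfolding bitangent_def F_def m_def by blast
qed

lemma fermat_in_B_btg: "det3 a b c \<noteq> 0 \<Longrightarrow> abs_cproj (fermat a b c) \<in> B_btg"
  using nonsingular_fermat[of a b c] nonsingular_form_nonzero[of "fermat a b c"]
  by (simp add: B_btg_def nonsingular.abs_eq) (auto intro!: nonsingular.abs_eq[THEN iffD2] exI[of _ "1::complex"])

section \<open>The bitangent cover\<close>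

definition herm :: "complex ^ 3 \<Rightarrow> complex ^ 3 \<Rightarrow> complex"
  where "herm v w = (\<Sum>i\<in>UNIV. v $ i * cnj (w $ i))"

definition conj_cross :: "complex ^ 3 \<Rightarrow> complex ^ 3 \<Rightarrow> complex ^ 3"
  where "conj_cross v w = vector [cnj (v $ 2 * w $ 3 - v $ 3 * w $ 2), cnj (v $ 3 * w $ 1 - v $ 1 * w $ 3),
    cnj (v $ 1 * w $ 2 - v $ 2 * w $ 1)]"

definition frames :: "((complex ^ 3) \<times> (complex ^ 3)) set"
  where "frames = {(v, w). v \<noteq> 0 \<and> w \<noteq> 0 \<and> herm v w = 0}"

lemma herm_minus [simp]: "herm (- v) w = - herm v w" "herm v (- w) = - herm v w"
  by (simp_all add: herm_def sum_negf)

lemma herm_self_nonzero: "v \<noteq> 0 \<Longrightarrow> herm v v \<noteq> 0"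
proof
  assume "v \<noteq> 0" "herm v v = 0"
  have "herm v v = of_real (\<Sum>i\<in>UNIV. (cmod (v $ i))\<^sup>2)"
    by (simp only: herm_def of_real_sum complex_norm_square)
  with \<open>herm v v = 0\<close> have "(\<Sum>i\<in>UNIV. (cmod (v $ i))\<^sup>2) = 0" by (metis of_real_eq_0_iff)
  then show False using \<open>v \<noteq> 0\<close> by (simp add: sum_nonneg_eq_0_iff vec_eq_iff)
qed

lemma conj_cross_minus [simp]: "conj_cross (- v) w = - conj_cross v w" "conj_cross v (- w) = - conj_cross v w"
  by (simp_all add: conj_cross_def vec_eq_iff forall_3 vector_3)

lemma frames_minus: "(v, w) \<in> frames \<Longrightarrow> (- v, w) \<in> frames" "(v, w) \<in> frames \<Longrightarrow> (v, - w) \<in> frames"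
  by (simp_all add: frames_def)

lemma det3_conj_cross: "det3 v w (conj_cross v w) = herm v v * herm w w - herm v w * herm w v"
  by (simp add: det3_def conj_cross_def herm_def sum_3 vector_3 algebra_simps)

lemma det3_frame: "(v, w) \<in> frames \<Longrightarrow> det3 v w (conj_cross v w) \<noteq> 0"
  by (simp add: det3_conj_cross frames_def herm_self_nonzero)

definition curve :: "(complex ^ 3) \<times> (complex ^ 3) \<Rightarrow> quartic_exp cproj"
  where "curve p = abs_cproj (fermat (fst p) (snd p) (conj_cross (fst p) (snd p)))"

definition tangent :: "(complex ^ 3) \<times> (complex ^ 3) \<Rightarrow> 3 cproj"
  where "tangent p = abs_cproj (fst p + snd p + conj_cross (fst p) (snd p))"

lemma curve_minus [simp]: "curve (- v, w) = curve (v, w)" "curve (v, - w) = curve (v, w)"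
  by (simp_all add: curve_def fermat_def pow4_minus)

lemma curve_in_B_btg: "p \<in> frames \<Longrightarrow> curve p \<in> B_btg"
  by (cases p) (simp add: curve_def fermat_in_B_btg det3_frame)

lemma bitangent_tangent: "p \<in> frames \<Longrightarrow> bitangent (curve p) (tangent p)"
  by (cases p) (simp add: curve_def tangent_def bitangent_fermat det3_frame)

lemma signed_sum_nonzero:
  assumes "det3 a b c \<noteq> 0" "\<alpha> \<noteq> 0"
  shows "\<alpha> *s a + \<beta> *s b + \<gamma> *s c \<noteq> 0"
proof
  assume "\<alpha> *s a + \<beta> *s b + \<gamma> *s c = 0"
  then have "\<alpha> * a $ i + \<beta> * b $ i + \<gamma> * c $ i = 0" for i by (simp add: vec_eq_iff)
  from det3_rows(1)[OF assms(1) this] show False using assms(2) by simp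
qed

lemma signed_sum_eq:
  assumes D: "det3 a b c \<noteq> 0" and \<alpha>: "\<alpha> \<noteq> 0"
    and eq: "abs_cproj (a + b + c) = abs_cproj (\<alpha> *s a + \<beta> *s b + \<gamma> *s c)"
  shows "\<alpha> = \<beta> \<and> \<beta> = \<gamma>"
proof -
  have "a + b + c \<noteq> 0" using signed_sum_nonzero[OF D, of 1 1 1] by simp
  then obtain d where d: "\<alpha> *s a + \<beta> *s b + \<gamma> *s c = d *s (a + b + c)"
    using eq signed_sum_nonzero[OF D \<alpha>] abs_cproj_eq_iff by blast
  have "(\<alpha> - d) * a $ i + (\<beta> - d) * b $ i + (\<gamma> - d) * c $ i = 0" for i
  proof -
    have "(\<alpha> *s a + \<beta> *s b + \<gamma> *s c) $ i = (d *s (a + b + c)) $ i" using d by simp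
    then show ?thesis by (simp add: algebra_simps)
  qed
  from det3_rows[OF D this] show ?thesis by simp
qed

lemma tangent_distinct:
  assumes "(v, w) \<in> frames"
  shows "tangent (- v, w) \<noteq> tangent (v, w)" "tangent (v, - w) \<noteq> tangent (v, w)"
    "tangent (- v, - w) \<noteq> tangent (v, w)"
proof -
  note D = det3_frame[OF assms]
  have *: "tangent (v, w) = abs_cproj (v + w + conj_cross v w)"
    "tangent (- v, w) = abs_cproj ((- 1) *s v + 1 *s w + (- 1) *s conj_cross v w)"
    "tangent (v, - w) = abs_cproj (1 *s v + (- 1) *s w + (- 1) *s conj_cross v w)"
    "tangent (- v, - w) = abs_cproj ((- 1) *s v + (- 1) *s w + 1 *s conj_cross v w)"
    by (simp_all add: tangent_def)
  show "tangent (- v, w) \<noteq> tangent (v, w)" "tangent (v, - w) \<noteq> tangent (v, w)"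
    "tangent (- v, - w) \<noteq> tangent (v, w)"
    unfolding * using signed_sum_eq[OF D, of "- 1" 1 "- 1"] signed_sum_eq[OF D, of 1 "- 1" "- 1"]
      signed_sum_eq[OF D, of "- 1" "- 1" 1] by fastforce+
qed

lemma continuous_on_conj_cross [continuous_intros]:
  assumes "continuous_on S f" "continuous_on S g"
  shows "continuous_on S (\<lambda>x. conj_cross (f x) (g x))"
proof -
  have "conj_cross v w = (\<chi> i. if i = 1 then cnj (v $ 2 * w $ 3 - v $ 3 * w $ 2)
      else if i = 2 then cnj (v $ 3 * w $ 1 - v $ 1 * w $ 3) else cnj (v $ 1 * w $ 2 - v $ 2 * w $ 1))" for v w
    by (simp add: conj_cross_def vec_eq_iff forall_3 vector_3)
  moreover have "continuous_on S (\<lambda>x. if i = 1 then cnj (f x $ 2 * g x $ 3 - f x $ 3 * g x $ 2)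
      else if i = 2 then cnj (f x $ 3 * g x $ 1 - f x $ 1 * g x $ 3) else cnj (f x $ 1 * g x $ 2 - f x $ 2 * g x $ 1))"
    for i :: 3
    using assms by (cases "i = 1"; cases "i = 2") (auto intro!: continuous_intros)
  ultimately show ?thesis by (simp add: continuous_on_vec_lambda)
qed

lemma continuous_on_curve: "continuous_on frames curve"
  unfolding curve_def
proof (rule continuous_on_compose2[OF continuous_on_abs_cproj])
  show "continuous_on frames (\<lambda>p. fermat (fst p) (snd p) (conj_cross (fst p) (snd p)))"
    unfolding fermat_def by (intro continuous_intros)
  show "(\<lambda>p. fermat (fst p) (snd p) (conj_cross (fst p) (snd p))) ` frames \<subseteq> {v. v \<noteq> 0}"
    using nonsingular_form_nonzero[OF nonsingular_fermat[OF det3_frame]] by auto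
qed

lemma continuous_on_tangent: "continuous_on frames tangent"
  unfolding tangent_def
proof (rule continuous_on_compose2[OF continuous_on_abs_cproj])
  show "continuous_on frames (\<lambda>p. fst p + snd p + conj_cross (fst p) (snd p))"
    by (intro continuous_intros)
  show "(\<lambda>p. fst p + snd p + conj_cross (fst p) (snd p)) ` frames \<subseteq> {v. v \<noteq> 0}"
    using signed_sum_nonzero[OF det3_frame, of _ _ 1 1 1] by auto
qed

lemma eventually_neq:
  fixes f g :: "'a \<Rightarrow> 'b::t2_space"
  assumes "(f \<longlongrightarrow> a) F" "(g \<longlongrightarrow> b) F" "a \<noteq> b"
  shows "\<forall>\<^sub>F x in F. f x \<noteq> g x"
proof -
  obtain U V where UV: "open U" "open V" "a \<in> U" "b \<in> V" "U \<inter> V = {}"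
    using hausdorff[OF assms(3)] by blast
  have "\<forall>\<^sub>F x in F. f x \<in> U" "\<forall>\<^sub>F x in F. g x \<in> V"
    using topological_tendstoD assms(1,2) UV by blast+
  then show ?thesis by eventually_elim (use UV(5) in auto)
qed

text \<open>The position in the list \<open>s (curve p)\<close> of the distinguished bitangent \<open>tangent p\<close> is locally
  constant, and the four sign changes of \<open>p\<close> give four different positions.\<close>

lemma section_signs:
  fixes b :: bool
  assumes U: "U \<subseteq> B_btg"
    and s: "continuous_on U s" "s ` U \<subseteq> E_btg" "\<And>x. x \<in> U \<Longrightarrow> fst (s x) = x"
    and X: "X = {p \<in> frames. curve p \<in> U}"
  obtains \<epsilon> :: "(complex ^ 3) \<times> (complex ^ 3) \<Rightarrow> real"
  where "continuous_on X \<epsilon>" "\<And>p. \<epsilon> p \<in> {-1, 1}"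
    "\<And>v w. (v, w) \<in> X \<Longrightarrow> \<epsilon> (- v, w) = (if b then - \<epsilon> (v, w) else \<epsilon> (v, w))"
    "\<And>v w. (v, w) \<in> X \<Longrightarrow> \<epsilon> (v, - w) = (if b then \<epsilon> (v, w) else - \<epsilon> (v, w))"
proof -
  define l where "l p = snd (s (curve p))" for p
  have l: "bij_betw (($) (l p)) UNIV {m. bitangent (curve p) m}" if "p \<in> X" for p
  proof -
    have "s (curve p) \<in> E_btg" "fst (s (curve p)) = curve p" using that s by (auto simp: X)
    then show ?thesis by (auto simp: E_btg_def l_def)
  qed
  obtain e :: "28 \<Rightarrow> nat" where e: "inj e"
    using finite_imp_inj_to_nat_seg[OF finite] by auto
  define J where "J p = (SOME j. l p $ j = tangent p)" for p
  have J: "l p $ J p = tangent p" if "p \<in> X" for p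
  proof -
    have "tangent p \<in> ($) (l p) ` UNIV"
      using l[OF that] bitangent_tangent that by (auto simp: bij_betw_def X)
    then have "\<exists>j. l p $ j = tangent p" by fastforce
    then show ?thesis unfolding J_def by (rule someI_ex)
  qed
  have X_minus: "(- v, w) \<in> X" "(v, - w) \<in> X" if "(v, w) \<in> X" for v w
    using that frames_minus by (auto simp: X)
  have l_minus: "l (- v, w) = l (v, w)" "l (v, - w) = l (v, w)" for v w
    by (simp_all add: l_def)
  have J_const: "\<forall>\<^sub>F p in at q within X. J p = J q" if q: "q \<in> X" for q
  proof -
    have tl: "((\<lambda>p. l p $ j) \<longlongrightarrow> l q $ j) (at q within X)" for j
    proof -
      have "continuous_on X (\<lambda>p. s (curve p))"
        by (rule continuous_on_compose2[OF s(1) continuous_on_subset[OF continuous_on_curve]]) (auto simp: X)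
      then have "continuous_on X (\<lambda>p. l p $ j)" unfolding l_def by (intro continuous_intros)
      then show ?thesis using q by (simp add: continuous_on_def)
    qed
    have tt: "(tangent \<longlongrightarrow> tangent q) (at q within X)"
    proof -
      have "continuous_on X tangent"
        by (rule continuous_on_subset[OF continuous_on_tangent]) (auto simp: X)
      then show ?thesis using q by (simp add: continuous_on_def)
    qed
    have "\<forall>\<^sub>F p in at q within X. \<forall>j\<in>UNIV - {J q}. l p $ j \<noteq> tangent p"
    proof (rule eventually_ball_finite)
      show "\<forall>j\<in>UNIV - {J q}. \<forall>\<^sub>F p in at q within X. l p $ j \<noteq> tangent p"
      proof
        fix j assume "j \<in> UNIV - {J q}"
        then have "l q $ j \<noteq> tangent q"
          using J[OF q] bij_betw_imp_inj_on[OF l[OF q]] by (metis DiffE UNIV_I injD insertCI)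
        then show "\<forall>\<^sub>F p in at q within X. l p $ j \<noteq> tangent p"
          by (rule eventually_neq[OF tl tt])
      qed
    qed simp
    moreover have "\<forall>\<^sub>F p in at q within X. p \<in> X" by (simp add: eventually_at_filter)
    ultimately show ?thesis by eventually_elim (use J in blast)
  qed
  define k where "k p = e (J p)" for p
  have k_const: "\<forall>\<^sub>F p in nhds q. p \<in> X \<longrightarrow> k p = k q" if "q \<in> X" for q
  proof -
    have "\<forall>\<^sub>F p in nhds q. p \<noteq> q \<longrightarrow> p \<in> X \<longrightarrow> J p = J q"
      using J_const[OF that] by (simp add: eventually_at_filter)
    then show ?thesis by eventually_elim (auto simp: k_def)
  qed
  have k_neq: "k (- v, w) \<noteq> k (v, w)" "k (v, - w) \<noteq> k (v, w)" "k (- v, - w) \<noteq> k (v, w)"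
    if "(v, w) \<in> X" for v w
  proof -
    have "(v, w) \<in> frames" using that by (simp add: X)
    from tangent_distinct[OF this]
    show "k (- v, w) \<noteq> k (v, w)" "k (v, - w) \<noteq> k (v, w)" "k (- v, - w) \<noteq> k (v, w)"
      using J[OF that] J[OF X_minus(1)[OF that]] J[OF X_minus(2)[OF that]]
        J[OF X_minus(2)[OF X_minus(1)[OF that]]] e
      unfolding k_def l_minus by (metis injD)+
  qed
  have k_distinct: "k (v, w) \<noteq> k (- v, w)" "k (v, w) \<noteq> k (- v, - w)" "k (v, w) \<noteq> k (v, - w)"
      "k (v, - w) \<noteq> k (- v, w)" "k (v, - w) \<noteq> k (- v, - w)" "k (- v, w) \<noteq> k (- v, - w)"
    if vw: "(v, w) \<in> X" for v w
    using k_neq[OF vw] k_neq[OF X_minus(1)[OF vw]] k_neq[OF X_minus(2)[OF vw]] by auto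
  have lc: "continuous_on X (\<lambda>(v, w). h (k (v, w)) (k (- v, w)) (k (v, - w)) (k (- v, - w)))"
    for h :: "nat \<Rightarrow> nat \<Rightarrow> nat \<Rightarrow> nat \<Rightarrow> real"
  proof -
    have *: "\<forall>\<^sub>F p in nhds q. p \<in> X \<longrightarrow> k (g p) = k (g q)"
      if "q \<in> X" "\<And>p. p \<in> X \<Longrightarrow> g p \<in> X" "continuous_on UNIV g" for q and g :: "(complex ^ 3) \<times> (complex ^ 3) \<Rightarrow> (complex ^ 3) \<times> (complex ^ 3)"
    proof -
      have "filterlim g (nhds (g q)) (nhds q)"
        using that(3) continuous_on_eq_continuous_within isCont_def tendsto_at_iff_tendsto_nhds by blast
      from eventually_compose_filterlim[OF k_const[OF that(2)[OF that(1)]] this]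
      show ?thesis using that(2) by (auto elim: eventually_mono)
    qed
    show ?thesis unfolding continuous_on_def
    proof
      fix q assume q: "q \<in> X"
      have c: "continuous_on UNIV (\<lambda>p::(complex ^ 3) \<times> (complex ^ 3). (- fst p, snd p))"
        "continuous_on UNIV (\<lambda>p::(complex ^ 3) \<times> (complex ^ 3). (fst p, - snd p))"
        "continuous_on UNIV (\<lambda>p::(complex ^ 3) \<times> (complex ^ 3). (- fst p, - snd p))"
        by (intro continuous_intros)+
      have "\<forall>\<^sub>F p in nhds q. p \<in> X \<longrightarrow> k p = k q"
        "\<forall>\<^sub>F p in nhds q. p \<in> X \<longrightarrow> k (- fst p, snd p) = k (- fst q, snd q)"
        "\<forall>\<^sub>F p in nhds q. p \<in> X \<longrightarrow> k (fst p, - snd p) = k (fst q, - snd q)"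
        "\<forall>\<^sub>F p in nhds q. p \<in> X \<longrightarrow> k (- fst p, - snd p) = k (- fst q, - snd q)"
        using k_const[OF q] *[OF q _ c(1)] *[OF q _ c(2)] *[OF q _ c(3)] X_minus by auto
      then have "\<forall>\<^sub>F p in nhds q. p \<in> X \<longrightarrow>
        (case p of (v, w) \<Rightarrow> h (k (v, w)) (k (- v, w)) (k (v, - w)) (k (- v, - w))) =
        (case q of (v, w) \<Rightarrow> h (k (v, w)) (k (- v, w)) (k (v, - w)) (k (- v, - w)))"
        by eventually_elim (auto simp: case_prod_unfold)
      then have "\<forall>\<^sub>F p in at q within X.
        (case p of (v, w) \<Rightarrow> h (k (v, w)) (k (- v, w)) (k (v, - w)) (k (- v, - w))) =
        (case q of (v, w) \<Rightarrow> h (k (v, w)) (k (- v, w)) (k (v, - w)) (k (- v, - w)))"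
        unfolding eventually_at_filter by eventually_elim auto
      then show "((\<lambda>(v, w). h (k (v, w)) (k (- v, w)) (k (v, - w)) (k (- v, - w))) \<longlongrightarrow>
        (case q of (v, w) \<Rightarrow> h (k (v, w)) (k (- v, w)) (k (v, - w)) (k (- v, - w)))) (at q within X)"
        by (rule tendsto_eventually)
    qed
  qed
  show ?thesis
  proof (cases b)
    case True
    define \<epsilon> :: "(complex ^ 3) \<times> (complex ^ 3) \<Rightarrow> real" where
      "\<epsilon> = (\<lambda>(v, w). if min (k (v, w)) (k (v, - w)) < min (k (- v, w)) (k (- v, - w)) then 1 else - 1)"
    show ?thesis
    proof (rule that[of \<epsilon>])
      show "continuous_on X \<epsilon>"
        unfolding \<epsilon>_def by (rule lc[of "\<lambda>x y z u. if min x z < min y u then 1 else - 1"])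
      fix v w assume "(v, w) \<in> X"
      from k_distinct[OF this] show "\<epsilon> (- v, w) = (if b then - \<epsilon> (v, w) else \<epsilon> (v, w))"
        using True by (auto simp: \<epsilon>_def min_def)
      show "\<epsilon> (v, - w) = (if b then \<epsilon> (v, w) else - \<epsilon> (v, w))"
        using True by (simp add: \<epsilon>_def min.commute)
    qed (auto simp: \<epsilon>_def)
  next
    case False
    define \<epsilon> :: "(complex ^ 3) \<times> (complex ^ 3) \<Rightarrow> real" where
      "\<epsilon> = (\<lambda>(v, w). if min (k (v, w)) (k (- v, w)) < min (k (v, - w)) (k (- v, - w)) then 1 else - 1)"
    show ?thesis
    proof (rule that[of \<epsilon>])
      show "continuous_on X \<epsilon>"
        unfolding \<epsilon>_def by (rule lc[of "\<lambda>x y z u. if min x y < min z u then 1 else - 1"])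
      fix v w assume "(v, w) \<in> X"
      from k_distinct[OF this] show "\<epsilon> (v, - w) = (if b then \<epsilon> (v, w) else - \<epsilon> (v, w))"
        using False by (auto simp: \<epsilon>_def min_def)
      show "\<epsilon> (- v, w) = (if b then - \<epsilon> (v, w) else \<epsilon> (v, w))"
        using False by (simp add: \<epsilon>_def min.commute)
    qed (auto simp: \<epsilon>_def)
  qed
qed

lemma exists_support_function:
  fixes X :: "'a::metric_space set"
  assumes "openin (top_of_set X) V"
  obtains \<rho> :: "'a \<Rightarrow> real" where "continuous_on X \<rho>" "\<And>x. 0 \<le> \<rho> x" "\<And>x. x \<in> X \<Longrightarrow> 0 < \<rho> x \<longleftrightarrow> x \<in> V"
proof (cases "X \<subseteq> V")
  case True
  then show ?thesis by (intro that[of "\<lambda>_. 1"]) auto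
next
  case False
  show ?thesis
  proof (rule that[of "\<lambda>x. infdist x (X - V)"])
    show "continuous_on X (\<lambda>x. infdist x (X - V))" by (intro continuous_intros)
    fix x assume x: "x \<in> X"
    obtain T where T: "closed T" "X - V = X \<inter> T"
      using assms by (metis closedin_closed closedin_diff closedin_subtopology_refl topspace_euclidean_subtopology closedin_topspace)
    have "x \<in> closure (X - V) \<longleftrightarrow> x \<in> X - V"
      using T x closure_minimal[of "X - V" T] closure_subset[of "X - V"] by auto
    then have "infdist x (X - V) = 0 \<longleftrightarrow> x \<in> X - V"
      using in_closure_iff_infdist_zero[of "X - V" x] False by auto
    then show "0 < infdist x (X - V) \<longleftrightarrow> x \<in> V"
      using x infdist_nonneg[of x "X - V"] by (metis DiffD2 DiffI less_eq_real_def less_irrefl)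
  qed (rule infdist_nonneg)
qed

lemma extend_by_zero:
  fixes \<rho> \<sigma> :: "'a::metric_space \<Rightarrow> real"
  assumes V: "openin (top_of_set X) V" and \<rho>: "continuous_on X \<rho>" "\<And>x. x \<in> X - V \<Longrightarrow> \<rho> x = 0"
    and \<sigma>: "continuous_on V \<sigma>" "\<And>x. \<bar>\<sigma> x\<bar> \<le> 1"
  shows "continuous_on X (\<lambda>x. if x \<in> V then \<rho> x * \<sigma> x else 0)"
  unfolding continuous_on_def
proof
  fix x assume x: "x \<in> X"
  show "((\<lambda>x. if x \<in> V then \<rho> x * \<sigma> x else 0) \<longlongrightarrow> (if x \<in> V then \<rho> x * \<sigma> x else 0)) (at x within X)"
  proof (cases "x \<in> V")
    case True
    have VX: "V \<subseteq> X" using V openin_imp_subset by blast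
    obtain T where T: "open T" "V = X \<inter> T" using V by (auto simp: openin_open)
    have "((\<lambda>x. \<rho> x * \<sigma> x) \<longlongrightarrow> \<rho> x * \<sigma> x) (at x within V)"
      using continuous_on_mult[OF continuous_on_subset[OF \<rho>(1) VX] \<sigma>(1)] True by (simp add: continuous_on_def)
    then have "((\<lambda>x. if x \<in> V then \<rho> x * \<sigma> x else 0) \<longlongrightarrow> \<rho> x * \<sigma> x) (at x within V)"
      by (rule Lim_transform_eventually) (simp add: eventually_at_filter)
    moreover have "at x within V = at x within X"
      using T True by (intro at_within_nhd[of x T]) auto
    ultimately show ?thesis using True by simp
  next
    case False
    have "((\<lambda>x. if x \<in> V then \<rho> x * \<sigma> x else 0) \<longlongrightarrow> 0) (at x within X)"
    proof (rule Lim_null_comparison)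
      have "\<bar>\<rho> y * \<sigma> y\<bar> \<le> \<bar>\<rho> y\<bar>" for y
        using \<sigma>(2)[of y] by (simp add: abs_mult mult_left_le)
      then show "\<forall>\<^sub>F y in at x within X. norm (if y \<in> V then \<rho> y * \<sigma> y else 0) \<le> \<bar>\<rho> y\<bar>"
        by (intro always_eventually) auto
      show "((\<lambda>y. \<bar>\<rho> y\<bar>) \<longlongrightarrow> 0) (at x within X)"
        using \<rho> x False by (auto simp: continuous_on_def intro!: tendsto_rabs_zero)
    qed
    then show ?thesis using False by simp
  qed
qed

text \<open>Averaging over the sign changes turns a Tietze extension into an equivariant one.\<close>

lemma equivariant_extension:
  fixes \<phi> :: "(complex ^ 3) \<times> (complex ^ 3) \<Rightarrow> real" and \<beta> \<gamma> :: real
  assumes "continuous_on frames \<phi>" and \<beta>\<gamma>: "\<beta> * \<beta> = 1" "\<gamma> * \<gamma> = 1"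
  obtains f where "continuous_on {(v, w). v \<noteq> 0 \<and> w \<noteq> 0} f"
    "\<And>v w. f (- v, w) = \<beta> * f (v, w)" "\<And>v w. f (v, - w) = \<gamma> * f (v, w)"
    "\<And>v w. (v, w) \<in> frames \<Longrightarrow>
      f (v, w) = \<phi> (v, w) + \<beta> * \<phi> (- v, w) + \<gamma> * \<phi> (v, - w) + \<beta> * \<gamma> * \<phi> (- v, - w)"
proof -
  let ?U = "{(v, w). v \<noteq> 0 \<and> w \<noteq> 0} :: ((complex ^ 3) \<times> (complex ^ 3)) set"
  have cl: "closed {p :: (complex ^ 3) \<times> (complex ^ 3). herm (fst p) (snd p) = 0}"
    unfolding herm_def by (intro closed_Collect_eq continuous_intros)
  have "frames = ?U \<inter> {p. herm (fst p) (snd p) = 0}" by (auto simp: frames_def)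
  then have cf: "closedin (top_of_set ?U) frames" using closedin_closed_Int[OF cl, of ?U] by simp
  obtain G where G: "continuous_on ?U G" "\<And>p. p \<in> frames \<Longrightarrow> G p = \<phi> p"
    by (rule Tietze_unbounded[OF assms(1) cf], rule that)
  define f where "f p = G p + \<beta> * G (- fst p, snd p) + \<gamma> * G (fst p, - snd p) + \<beta> * \<gamma> * G (- fst p, - snd p)"
    for p
  show ?thesis
  proof (rule that[of f])
    show "continuous_on ?U f" unfolding f_def
      by (intro continuous_intros G(1) continuous_on_compose2[OF G(1)]) auto
    have \<beta>': "\<beta> * (\<beta> * x) = x" and \<gamma>': "\<gamma> * (\<gamma> * x) = x" for x
      using \<beta>\<gamma> by (simp_all flip: mult.assoc)
    show "f (- v, w) = \<beta> * f (v, w)" "f (v, - w) = \<gamma> * f (v, w)" for v w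
      by (simp_all add: f_def distrib_left \<beta>' \<gamma>' mult.left_commute[of \<gamma> \<beta>] mult.assoc)
    show "f (v, w) = \<phi> (v, w) + \<beta> * \<phi> (- v, w) + \<gamma> * \<phi> (v, - w) + \<beta> * \<gamma> * \<phi> (- v, - w)"
      if "(v, w) \<in> frames" for v w
      using that frames_minus G(2) by (simp add: f_def)
  qed
qed

lemma cover_function:
  fixes b :: bool
  assumes U: "openin (top_of_set B_btg) U"
    and s: "continuous_map (subtopology (top_of_set B_btg) U) (top_of_set E_btg) s" "\<And>x. x \<in> U \<Longrightarrow> fst (s x) = x"
  obtains f :: "(complex ^ 3) \<times> (complex ^ 3) \<Rightarrow> real"
  where "continuous_on {(v, w). v \<noteq> 0 \<and> w \<noteq> 0} f"
    "\<And>v w. f (- v, w) = (if b then - f (v, w) else f (v, w))"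
    "\<And>v w. f (v, - w) = (if b then f (v, w) else - f (v, w))"
    "\<And>p. p \<in> frames \<Longrightarrow> curve p \<in> U \<Longrightarrow> f p \<noteq> 0"
proof -
  have UB: "U \<subseteq> B_btg" using U openin_imp_subset by blast
  have s': "continuous_on U s" "s ` U \<subseteq> E_btg"
    using s(1) UB by (auto simp: subtopology_subtopology Int_absorb1 continuous_map_in_subtopology)
  define X where "X = {p \<in> frames. curve p \<in> U}"
  obtain T where T: "open T" "U = B_btg \<inter> T" using U by (auto simp: openin_open)
  have "X = frames \<inter> curve -` T" using T curve_in_B_btg by (auto simp: X_def)
  then have X: "openin (top_of_set frames) X"
    using continuous_openin_preimage_gen[OF continuous_on_curve T(1)] by simp
  obtain \<epsilon> :: "(complex ^ 3) \<times> (complex ^ 3) \<Rightarrow> real" where \<epsilon>': "continuous_on X \<epsilon>" "\<And>p. \<epsilon> p \<in> {-1, 1}"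
    "\<And>v w. (v, w) \<in> X \<Longrightarrow> \<epsilon> (- v, w) = (if b then - \<epsilon> (v, w) else \<epsilon> (v, w))"
    "\<And>v w. (v, w) \<in> X \<Longrightarrow> \<epsilon> (v, - w) = (if b then \<epsilon> (v, w) else - \<epsilon> (v, w))"
    by (rule section_signs[OF UB s' s(2) X_def], assumption, rule that)
  define \<beta> \<gamma> :: real where "\<beta> = (if b then - 1 else 1)" and "\<gamma> = (if b then 1 else - 1)"
  have \<epsilon>: "continuous_on X \<epsilon>" "\<And>p. \<epsilon> p \<in> {-1, 1}"
    "\<And>v w. (v, w) \<in> X \<Longrightarrow> \<epsilon> (- v, w) = \<beta> * \<epsilon> (v, w)" "\<And>v w. (v, w) \<in> X \<Longrightarrow> \<epsilon> (v, - w) = \<gamma> * \<epsilon> (v, w)"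
    using \<epsilon>' by (simp_all add: \<beta>_def \<gamma>_def)
  obtain \<rho> :: "(complex ^ 3) \<times> (complex ^ 3) \<Rightarrow> real" where \<rho>: "continuous_on frames \<rho>" "\<And>p. 0 \<le> \<rho> p" "\<And>p. p \<in> frames \<Longrightarrow> 0 < \<rho> p \<longleftrightarrow> p \<in> X"
    by (rule exists_support_function[OF X], rule that)
  let ?\<phi> = "\<lambda>p. if p \<in> X then \<rho> p * \<epsilon> p else 0"
  have "continuous_on frames ?\<phi>"
  proof (rule extend_by_zero[OF X \<rho>(1) _ \<epsilon>(1)])
    show "\<rho> p = 0" if "p \<in> frames - X" for p using \<rho>(2)[of p] \<rho>(3)[of p] that by auto
    show "\<bar>\<epsilon> p\<bar> \<le> 1" for p using \<epsilon>(2)[of p] by auto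
  qed
  then obtain f where f: "continuous_on {(v, w). v \<noteq> 0 \<and> w \<noteq> 0} f"
    "\<And>v w. f (- v, w) = \<beta> * f (v, w)" "\<And>v w. f (v, - w) = \<gamma> * f (v, w)"
    "\<And>v w. (v, w) \<in> frames \<Longrightarrow>
      f (v, w) = ?\<phi> (v, w) + \<beta> * ?\<phi> (- v, w) + \<gamma> * ?\<phi> (v, - w) + \<beta> * \<gamma> * ?\<phi> (- v, - w)"
    by (rule equivariant_extension[of ?\<phi> \<beta> \<gamma>]) (simp_all add: \<beta>_def \<gamma>_def)
  show ?thesis
  proof (rule that[OF f(1)])
    fix p assume p: "p \<in> frames" "curve p \<in> U"
    obtain v w where vw: "p = (v, w)" by fastforce
    have X4: "(v, w) \<in> X" "(- v, w) \<in> X" "(v, - w) \<in> X" "(- v, - w) \<in> X"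
      using p frames_minus by (simp_all add: X_def vw)
    have \<beta>\<gamma>: "\<beta> * (\<beta> * x) = x" "\<gamma> * (\<gamma> * x) = x" for x by (simp_all add: \<beta>_def \<gamma>_def)
    have "f (v, w) = \<rho> (v, w) * \<epsilon> (v, w) + \<beta> * (\<rho> (- v, w) * \<epsilon> (- v, w)) +
        \<gamma> * (\<rho> (v, - w) * \<epsilon> (v, - w)) + \<beta> * \<gamma> * (\<rho> (- v, - w) * \<epsilon> (- v, - w))"
      using f(4)[of v w] p(1) X4 by (simp add: vw)
    also have "\<dots> = (\<rho> (v, w) + \<rho> (- v, w) + \<rho> (v, - w) + \<rho> (- v, - w)) * \<epsilon> (v, w)"
      using \<epsilon>(3)[OF X4(1)] \<epsilon>(4)[OF X4(1)] \<epsilon>(4)[OF X4(2)]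
      by (cases b) (simp_all add: \<beta>_def \<gamma>_def algebra_simps)
    finally have "f p = (\<rho> (v, w) + \<rho> (- v, w) + \<rho> (v, - w) + \<rho> (- v, - w)) * \<epsilon> p" by (simp add: vw)
    moreover have "\<rho> (v, w) + \<rho> (- v, w) + \<rho> (v, - w) + \<rho> (- v, - w) > 0"
      using \<rho>(2) \<rho>(3)[of "(v, w)"] p(1) X4(1) by (simp add: vw add_pos_nonneg)
    moreover have "\<epsilon> p \<noteq> 0" using \<epsilon>(2)[of p] by auto
    ultimately show "f p \<noteq> 0" by simp
  qed (use f(2,3) in \<open>auto simp: \<beta>_def \<gamma>_def\<close>)
qed

lemma no_small_cover:
  fixes U :: "nat \<Rightarrow> quartic_exp cproj set"
  assumes U: "\<And>i. i < 8 \<Longrightarrow> openin (top_of_set B_btg) (U i)" "(\<Union>i<8. U i) = B_btg"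
    and s: "\<And>i. i < 8 \<Longrightarrow> \<exists>s. continuous_map (subtopology (top_of_set B_btg) (U i)) (top_of_set E_btg) s \<and>
      (\<forall>x\<in>U i. fst (s x) = x)"
  shows False
proof -
  define P where "P i f \<longleftrightarrow> continuous_on {(v, w). v \<noteq> 0 \<and> w \<noteq> 0} f \<and>
    (\<forall>v w. f (- v, w) = (if i < 5 then - f (v, w) else f (v, w))) \<and>
    (\<forall>v w. f (v, - w) = (if i < 5 then f (v, w) else - f (v, w))) \<and>
    (\<forall>p. p \<in> frames \<longrightarrow> curve p \<in> U i \<longrightarrow> f p \<noteq> 0)"
    for i and f :: "(complex ^ 3) \<times> (complex ^ 3) \<Rightarrow> real"
  have "\<forall>i\<in>{..<8}. \<exists>f. P i f"
  proof
    fix i :: nat assume "i \<in> {..<8}"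
    then have i: "i < 8" by simp
    obtain s where s: "continuous_map (subtopology (top_of_set B_btg) (U i)) (top_of_set E_btg) s"
      "\<And>x. x \<in> U i \<Longrightarrow> fst (s x) = x" using s[OF i] by blast
    obtain f :: "(complex ^ 3) \<times> (complex ^ 3) \<Rightarrow> real"
      where "continuous_on {(v, w). v \<noteq> 0 \<and> w \<noteq> 0} f"
        "\<And>v w. f (- v, w) = (if i < 5 then - f (v, w) else f (v, w))"
        "\<And>v w. f (v, - w) = (if i < 5 then f (v, w) else - f (v, w))"
        "\<And>p. p \<in> frames \<Longrightarrow> curve p \<in> U i \<Longrightarrow> f p \<noteq> 0"
      by (rule cover_function[OF U(1)[OF i] s, of "i < 5"], assumption, rule that)
    then show "\<exists>f. P i f" unfolding P_def by (intro exI[of _ f]) (simp del: split_paired_All)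
  qed
  from bchoice[OF this] obtain f where "\<forall>i\<in>{..<8}. P i (f i)" by blast
  then have f: "\<And>i. i < 8 \<Longrightarrow> continuous_on {(v, w). v \<noteq> 0 \<and> w \<noteq> 0} (f i)"
    "\<And>i v w. i < 8 \<Longrightarrow> f i (- v, w) = (if i < 5 then - f i (v, w) else f i (v, w))"
    "\<And>i v w. i < 8 \<Longrightarrow> f i (v, - w) = (if i < 5 then f i (v, w) else - f i (v, w))"
    "\<And>i p. i < 8 \<Longrightarrow> p \<in> frames \<Longrightarrow> curve p \<in> U i \<Longrightarrow> f i p \<noteq> 0"
    by (simp_all add: P_def del: split_paired_All)
  define F :: "nat \<Rightarrow> (complex ^ 3) \<times> (complex ^ 3) \<Rightarrow> real" where
    "F i p = (if i < 8 then f i p else if i = 8 then Re (herm (fst p) (snd p)) else Im (herm (fst p) (snd p)))" for i p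
  obtain v w where vw: "v \<noteq> 0" "w \<noteq> 0" "\<And>i. i < 10 \<Longrightarrow> F i (v, w) = 0"
  proof (rule product_borsuk_ulam[of F "\<lambda>i. i < 5 \<or> 8 \<le> i" "\<lambda>i. 5 \<le> i"])
    show "continuous_on {(v, w). v \<noteq> 0 \<and> w \<noteq> 0} (F i)" for i
      using f(1)[of i] unfolding F_def[abs_def] herm_def
      by (cases "i < 8"; cases "i = 8") (simp_all add: continuous_intros)
  qed (use f(2,3) in \<open>auto simp: F_def\<close>)
  have "Re (herm v w) = 0" "Im (herm v w) = 0" using vw(3)[of 8] vw(3)[of 9] by (simp_all add: F_def)
  then have fr: "(v, w) \<in> frames" using vw by (simp add: frames_def complex_eq_iff)
  then obtain i where "i < 8" "curve (v, w) \<in> U i" using curve_in_B_btg U(2) by blast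
  then show False using f(4)[OF _ fr] vw(3)[of i] by (simp add: F_def)
qed

theorem theorem1p3:
  shows "schwarz_genus (top_of_set E_btg) (top_of_set B_btg) fst \<ge> 9"
proof (rule ccontr)
  assume "\<not> ?thesis"
  then obtain \<U> :: "quartic_exp cproj set set" where card: "enat (card \<U>) < 9" and fin: "finite \<U>"
    and op: "\<And>U. U \<in> \<U> \<Longrightarrow> openin (top_of_set B_btg) U" and cov: "\<Union>\<U> = B_btg"
    and sec: "\<And>U. U \<in> \<U> \<Longrightarrow> \<exists>s. continuous_map (subtopology (top_of_set B_btg) U) (top_of_set E_btg) s \<and>
      (\<forall>x\<in>U. fst (s x) = x)"
    unfolding schwarz_genus_def not_le Inf_less_iff by auto
  have card8: "card \<U> \<le> 8" using card by (simp add: numeral_eq_enat)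
  have "herm (axis 1 1) (axis 2 1) = 0" by (simp add: herm_def sum_3 axis_def)
  then have "(axis 1 1, axis 2 1) \<in> frames" by (simp add: frames_def axis_eq_0_iff)
  then have "B_btg \<noteq> {}" using curve_in_B_btg by blast
  then obtain U0 where U0: "U0 \<in> \<U>" using cov by blast
  obtain h where h: "bij_betw h {..<card \<U>} \<U>"
    using ex_bij_betw_nat_finite[OF fin] by (auto simp: atLeast0LessThan)
  define g where "g i = (if i < card \<U> then h i else U0)" for i
  have g: "g i \<in> \<U>" for i using h U0 by (auto simp: g_def bij_betw_def)
  have "\<exists>i<8. g i = U" if U: "U \<in> \<U>" for U
  proof -
    have "U \<in> h ` {..<card \<U>}" using h U by (simp add: bij_betw_def)
    then obtain i where "i < card \<U>" "h i = U" by blast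
    then show ?thesis using card8 by (intro exI[of _ i]) (simp add: g_def)
  qed
  then have "g ` {..<8} = \<U>" using g by (auto simp: image_iff)
  then have "(\<Union>i<8. g i) = B_btg" using cov by simp
  then show False by (intro no_small_cover[of g]) (use op sec g in auto)
qed

end
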